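(* (i) Let $\mathcal X$ be an $n$-correct set, $n\ge 2$, and let $B\in\mathcal X$ be a fixed node. Then there are at most $n$ special triplets of $\mathcal X$ containing $B$. If there are $n$ such triplets, then $\mathcal X$ has exactly $n$ maximal lines not passing through $B$. (ii) Let $\mathcal X$ be a $GC_n$ set, $n\ge 3$, and let $B\in\mathcal X$ be a fixed node. Then there are at most $n$ used $2$-node lines passing through $B$. If there are $n$ such lines, then $\mathcal X$ has exactly $n+1$ maximal lines, of which $n$ do not pass through $B$ and one passes through $B$; thus $\mathcal X$ is a Carnicer-Gasca set of degree $n$.
   Context: $\Pi_n$ is the space of real bivariate polynomials of total degree $\le n$, and $N=\dim\Pi_n=\frac12(n+1)(n+2)$. A finite set $\mathcal X\subset\mathbb R^2$ of (distinct) nodes is $n$-correct if for every assignment of real values to the nodes there is a unique $p\in\Pi_n$ taking these values at the nodes (so $\#\mathcal X=N$). The $n$-fundamental polynomial $p^\star_A=p^\star_{A,\mathcal X}\in\Pi_n$ of $A\in\mathcal X$ is the one with $p^\star_A(A)=1$ and $p^\star_A=0$ on $\mathcal X\setminus\{A\}$. An $n$-correct set is a $GC_n$ set if the $n$-fundamental polynomial of each node is a product of $n$ linear factors. The same letter denotes a polynomial and the curve (zero set) it defines. A $k$-node line is a line passing through exactly $k$ nodes of $\mathcal X$; a maximal line of an $n$-correct set is an $(n+1)$-node line. A node $A\in\mathcal X$ uses a line $\ell$ if $\ell$ divides $p^\star_A$; a line is used if some node of $\mathcal X$ uses it. Put $d(n,k)=\frac12k(2n+3-k)$. A curve of degree $k\le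 n$ is a maximal curve for the $n$-correct set $\mathcal X$ if it passes through $d(n,k)$ nodes of $\mathcal X$. A set of three nodes $\{A,B,C\}\subset\mathcal X$ is a special triplet of $\mathcal X$ if there is a maximal curve $f$ of degree $n-1$ for $\mathcal X$ with $\mathcal X\setminus f=\{A,B,C\}$. A Carnicer-Gasca set of degree $n$ is a set obtained as follows: take $n+1$ lines $\ell_0,\dots,\ell_n$ in general position (no two parallel, no three concurrent); the set consists of the $\binom{n+1}{2}$ intersection points $\ell_i\cap\ell_j$, $0\le i<j\le n$, together with $n+1$ other points $A_i\in\ell_i$, $0\le i\le n$, that are noncollinear (not all on one line). *)

theory Defs
  imports Complex_Main "HOL-Computational_Algebra.Computational_Algebra"
begin

type_synonym point = "real \<times> real"

text \<open>A bivariate real polynomial is a polynomial in \<open>y\<close> whose coefficients are polynomials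
  in \<open>x\<close>: \<open>coeff (coeff p j) i\<close> is the coefficient of \<open>x\<^sup>i y\<^sup>j\<close>.\<close>

type_synonym bipoly = "real poly poly"

definition eval2 :: "bipoly \<Rightarrow> point \<Rightarrow> real" where
  "eval2 p P = poly (poly p [:snd P:]) (fst P)"

definition Pi_space :: "nat \<Rightarrow> bipoly set" where
  "Pi_space n = {p. \<forall>i j. coeff (coeff p j) i \<noteq> 0 \<longrightarrow> i + j \<le> n}"

text \<open>The zero polynomial gets total degree 0.\<close>

definition total_degree :: "bipoly \<Rightarrow> nat" where
  "total_degree p = (LEAST n. p \<in> Pi_space n)"

definition zero_set :: "bipoly \<Rightarrow> point set" where
  "zero_set p = {P. eval2 p P = 0}"

definition n_correct :: "nat \<Rightarrow> point set \<Rightarrow> bool" where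
  "n_correct n X \<longleftrightarrow> finite X \<and>
     (\<forall>c :: point \<Rightarrow> real. \<exists>!p. p \<in> Pi_space n \<and> (\<forall>P\<in>X. eval2 p P = c P))"

text \<open>Only meaningful if \<open>X\<close> is \<open>n\<close>-correct and \<open>A \<in> X\<close>, which makes the description unique.\<close>

definition fundamental_poly :: "nat \<Rightarrow> point set \<Rightarrow> point \<Rightarrow> bipoly" where
  "fundamental_poly n X A =
     (THE p. p \<in> Pi_space n \<and> eval2 p A = 1 \<and> (\<forall>P\<in>X - {A}. eval2 p P = 0))"

text \<open>A nonzero constant factor can be absorbed into a linear factor, so none is written here.\<close>

definition GC_set :: "nat \<Rightarrow> point set \<Rightarrow> bool" where
  "GC_set n X \<longleftrightarrow> n_correct n X \<and>
     (\<forall>A\<in>X. \<exists>ls. length ls = n \<and> (\<forall>l\<in>set ls. total_degree l = 1) \<and>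
        fundamental_poly n X A = prod_list ls)"

text \<open>Lines are point sets, so that proportional linear polynomials give a single line when
  lines are counted.\<close>

definition is_line :: "point set \<Rightarrow> bool" where
  "is_line L \<longleftrightarrow> (\<exists>l. total_degree l = 1 \<and> L = zero_set l)"

definition node_line :: "point set \<Rightarrow> nat \<Rightarrow> point set \<Rightarrow> bool" where
  "node_line X k L \<longleftrightarrow> is_line L \<and> card (L \<inter> X) = k"

definition maximal_line :: "nat \<Rightarrow> point set \<Rightarrow> point set \<Rightarrow> bool" where
  "maximal_line n X L \<longleftrightarrow> node_line X (n + 1) L"

definition uses_line :: "nat \<Rightarrow> point set \<Rightarrow> point \<Rightarrow> point set \<Rightarrow> bool" where
  "uses_line n X A L \<longleftrightarrow>
     (\<exists>l. total_degree l = 1 \<and> L = zero_set l \<and> l dvd fundamental_poly n X A)"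

definition used_line :: "nat \<Rightarrow> point set \<Rightarrow> point set \<Rightarrow> bool" where
  "used_line n X L \<longleftrightarrow> (\<exists>A\<in>X. uses_line n X A L)"

text \<open>For \<open>k \<le> n\<close> the subtraction is not truncated, and the division by 2 is exact since
  \<open>k\<close> and \<open>2 n + 3 - k\<close> have different parity.\<close>

definition d_num :: "nat \<Rightarrow> nat \<Rightarrow> nat" where
  "d_num n k = k * (2 * n + 3 - k) div 2"

definition maximal_curve :: "nat \<Rightarrow> point set \<Rightarrow> nat \<Rightarrow> bipoly \<Rightarrow> bool" where
  "maximal_curve n X k f \<longleftrightarrow>
     k \<le> n \<and> f \<noteq> 0 \<and> total_degree f = k \<and> card (X \<inter> zero_set f) = d_num n k"

definition special_triplet :: "nat \<Rightarrow> point set \<Rightarrow> point set \<Rightarrow> bool" where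
  "special_triplet n X T \<longleftrightarrow> T \<subseteq> X \<and> card T = 3 \<and>
     (\<exists>f. maximal_curve n X (n - 1) f \<and> X - zero_set f = T)"

text \<open>No two of the points \<open>A i\<close> can coincide, because the \<open>A i\<close> avoid all the
  intersection points; hence distinctness of the \<open>A i\<close> is not required separately.\<close>

definition Carnicer_Gasca_set :: "nat \<Rightarrow> point set \<Rightarrow> bool" where
  "Carnicer_Gasca_set n X \<longleftrightarrow>
     (\<exists>(l :: nat \<Rightarrow> point set) (A :: nat \<Rightarrow> point).
        (\<forall>i\<le>n. is_line (l i)) \<and>
        (\<forall>i j. i < j \<and> j \<le> n \<longrightarrow> l i \<noteq> l j \<and> l i \<inter> l j \<noteq> {}) \<and>
        (\<forall>i j k. i < j \<and> j < k \<and> k \<le> n \<longrightarrow> l i \<inter> l j \<inter> l k = {}) \<and>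
        (\<forall>i\<le>n. A i \<in> l i \<and> A i \<notin> {P. \<exists>i j. i < j \<and> j \<le> n \<and> P \<in> l i \<inter> l j}) \<and>
        \<not> (\<exists>L. is_line L \<and> A ` {..n} \<subseteq> L) \<and>
        X = {P. \<exists>i j. i < j \<and> j \<le> n \<and> P \<in> l i \<inter> l j} \<union> A ` {..n})"

end

theory Submission
  imports Defs
begin

text \<open>A special triplet \<open>T = {B, A, C}\<close> with curve \<open>f\<close> gives
  \<open>p\<^sup>\<star>\<^sub>B = \<ell>\<^sub>T f\<close> up to a constant, where \<open>\<ell>\<^sub>T\<close> is the line \<open>AC\<close>; the line determines
  \<open>f\<close> and hence \<open>T\<close>, so there are at most \<open>n\<close> triplets. For two triplets write
  \<open>p\<^sup>\<star>\<^sub>B = \<ell>\<^sub>1 \<ell>\<^sub>2 g\<close> and let \<open>k\<close> be a conic through \<open>B, A\<^sub>1, C\<^sub>1, A\<^sub>2, C\<^sub>2\<close>. The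
  polynomial \<open>k g\<close> vanishes at every node outside \<open>\<ell>\<^sub>1 \<inter> \<ell>\<^sub>2\<close>, so by correctness this
  intersection is a node \<open>D\<close>, with \<open>g(D) \<noteq> 0\<close> and \<open>p\<^sup>\<star>\<^sub>D = k g\<close> up to a constant. If there
  are \<open>n\<close> triplets, each of their lines therefore carries \<open>n - 1\<close> intersection nodes and two
  nodes of its own, so it is maximal.

  In a \<open>GC\<^sub>n\<close> set the conic \<open>k\<close> splits into two lines, which forces a point of \<open>{A\<^sub>1, C\<^sub>1}\<close>
  and a point of \<open>{A\<^sub>2, C\<^sub>2}\<close> onto a common line through \<open>B\<close>. Consequently, as soon as there
  are two triplets, each of them contains the nodes of at most one used 2-node line through
  \<open>B\<close>. In the extremal case the points not on used 2-node lines line up with \<open>B\<close> to form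
  the last maximal line.\<close>

subsection \<open>Bivariate polynomials and division by lines\<close>

lemma eval2_simps [simp]:
  "eval2 0 P = 0" "eval2 1 P = 1"
  "eval2 (p + q) P = eval2 p P + eval2 q P"
  "eval2 (p - q) P = eval2 p P - eval2 q P"
  "eval2 (- p) P = - eval2 p P"
  "eval2 (p * q) P = eval2 p P * eval2 q P"
  "eval2 (smult r p) P = poly r (fst P) * eval2 p P"
  by (auto simp: eval2_def)

lemma eval2_const [simp]: "eval2 [:[:c:]:] P = c"
  by (simp add: eval2_def)

lemma eval2_prod: "eval2 (\<Prod>x\<in>S. f x) P = (\<Prod>x\<in>S. eval2 (f x) P)"
  by (induction S rule: infinite_finite_induct) auto

lemma zero_set_iff: "P \<in> zero_set p \<longleftrightarrow> eval2 p P = 0"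
  by (simp add: zero_set_def)

section \<open>Arithmetic of total degree bounds\<close>

lemma Pi_space_iff_degree:
  "p \<in> Pi_space n \<longleftrightarrow> (\<forall>j. coeff p j \<noteq> 0 \<longrightarrow> degree (coeff p j) + j \<le> n)"
proof
  assume p: "p \<in> Pi_space n"
  show "\<forall>j. coeff p j \<noteq> 0 \<longrightarrow> degree (coeff p j) + j \<le> n"
    using p by (auto simp: Pi_space_def leading_coeff_neq_0)
next
  assume *: "\<forall>j. coeff p j \<noteq> 0 \<longrightarrow> degree (coeff p j) + j \<le> n"
  show "p \<in> Pi_space n"
    unfolding Pi_space_def
  proof safe
    fix i j
    assume "coeff (coeff p j) i \<noteq> 0"
    then have "coeff p j \<noteq> 0" "i \<le> degree (coeff p j)"
      by (auto intro: le_degree)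
    then show "i + j \<le> n"
      using * by fastforce
  qed
qed

lemma Pi_space_zero [simp]: "0 \<in> Pi_space n"
  by (simp add: Pi_space_def)

lemma Pi_space_diff: "p \<in> Pi_space n \<Longrightarrow> q \<in> Pi_space n \<Longrightarrow> p - q \<in> Pi_space n"
  unfolding Pi_space_def by force

lemma Pi_space_mono: "p \<in> Pi_space m \<Longrightarrow> m \<le> n \<Longrightarrow> p \<in> Pi_space n"
  unfolding Pi_space_def by force

lemma Pi_space_mult:
  assumes "p \<in> Pi_space m" "q \<in> Pi_space n"
  shows "p * q \<in> Pi_space (m + n)"
  unfolding Pi_space_def
proof safe
  fix i j
  assume "coeff (coeff (p * q) j) i \<noteq> 0"
  then have "(\<Sum>k\<le>j. \<Sum>h\<le>i. coeff (coeff p k) h * coeff (coeff q (j - k)) (i - h)) \<noteq> 0"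
    by (simp add: coeff_mult coeff_sum)
  then obtain k where "k \<le> j"
      and "(\<Sum>h\<le>i. coeff (coeff p k) h * coeff (coeff q (j - k)) (i - h)) \<noteq> 0"
    by (metis (no_types, lifting) atMost_iff sum.neutral)
  then obtain h where "h \<le> i" and "coeff (coeff p k) h * coeff (coeff q (j - k)) (i - h) \<noteq> 0"
    by (metis (no_types, lifting) atMost_iff sum.neutral)
  then have "coeff (coeff p k) h \<noteq> 0" "coeff (coeff q (j - k)) (i - h) \<noteq> 0"
    by auto
  then have "h + k \<le> m" "(i - h) + (j - k) \<le> n"
    using assms unfolding Pi_space_def by blast+
  then show "i + j \<le> m + n"
    using \<open>k \<le> j\<close> \<open>h \<le> i\<close> by linarith
qed

lemma Pi_space_const [simp]: "[:[:c:]:] \<in> Pi_space n"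
  by (auto simp: Pi_space_def coeff_pCons split: nat.splits)

lemma Pi_space_smult: "p \<in> Pi_space n \<Longrightarrow> smult [:c:] p \<in> Pi_space n"
  using Pi_space_mult[of "[:[:c:]:]" 0 p n] by simp

text \<open>Together with the case of degree bound 0, this unfolds a total degree bound along the
  coefficients in y, so that later bounds can be proved by induction over
  \<open>pCons\<close>.\<close>

lemma Pi_space_pCons_Suc:
  "pCons a p \<in> Pi_space (Suc n) \<longleftrightarrow> degree a \<le> Suc n \<and> p \<in> Pi_space n"
proof
  assume *: "pCons a p \<in> Pi_space (Suc n)"
  have "degree a \<le> Suc n"
    using *[unfolded Pi_space_iff_degree, rule_format, of 0] by (cases "a = 0") auto
  moreover have "p \<in> Pi_space n"
    unfolding Pi_space_iff_degree
  proof safe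
    fix j
    assume "coeff p j \<noteq> 0"
    then show "degree (coeff p j) + j \<le> n"
      using *[unfolded Pi_space_iff_degree, rule_format, of "Suc j"] by simp
  qed
  ultimately show "degree a \<le> Suc n \<and> p \<in> Pi_space n" ..
next
  assume "degree a \<le> Suc n \<and> p \<in> Pi_space n"
  then show "pCons a p \<in> Pi_space (Suc n)"
    by (auto simp: Pi_space_iff_degree coeff_pCons split: nat.splits)
qed

lemma Pi_space_pCons_0: "pCons a p \<in> Pi_space 0 \<longleftrightarrow> degree a = 0 \<and> p = 0"
proof
  assume *: "pCons a p \<in> Pi_space 0"
  have "degree a = 0"
    using *[unfolded Pi_space_iff_degree, rule_format, of 0] by (cases "a = 0") auto
  moreover have "p = 0"
  proof (rule poly_eqI)
    fix j
    show "coeff p j = coeff 0 j"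
      using *[unfolded Pi_space_iff_degree, rule_format, of "Suc j"] by auto
  qed
  ultimately show "degree a = 0 \<and> p = 0" ..
next
  assume "degree a = 0 \<and> p = 0"
  then show "pCons a p \<in> Pi_space 0"
    by (auto simp: Pi_space_iff_degree coeff_pCons split: nat.splits)
qed

lemma Pi_space_0_const:
  assumes "p \<in> Pi_space 0"
  obtains c where "p = [:[:c:]:]"
proof -
  obtain a q where p: "p = pCons a q"
    by (cases p)
  then have "degree a = 0" "q = 0"
    using assms Pi_space_pCons_0 by auto
  then show ?thesis
    using p that degree_eq_zeroE by metis
qed

lemma Pi_space_exists: "\<exists>n. p \<in> Pi_space n"
proof (induction p)
  case 0
  then show ?case by auto
next
  case (pCons a p)
  then obtain n where "p \<in> Pi_space n" by auto
  then have "p \<in> Pi_space (max n (degree a))"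
    using Pi_space_mono by fastforce
  then show ?case
    using Pi_space_pCons_Suc[of a p "max n (degree a)"] by (metis le_SucI max.cobounded2)
qed

lemma Pi_space_total_degree: "p \<in> Pi_space (total_degree p)"
  unfolding total_degree_def using Pi_space_exists by (rule LeastI_ex)

section \<open>Linear polynomials and lines in the plane\<close>

definition lin :: "real \<Rightarrow> real \<Rightarrow> real \<Rightarrow> bipoly" where
  "lin a b c = [:[:c, a:], [:b:]:]"

lemma eval2_lin [simp]: "eval2 (lin a b c) P = a * fst P + b * snd P + c"
  by (simp add: eval2_def lin_def)

lemma Pi_space_lin [simp]: "lin a b c \<in> Pi_space 1"
  by (auto simp: lin_def Pi_space_iff_degree coeff_pCons split: nat.splits)

lemma total_degree_1_iff:
  "total_degree l = 1 \<longleftrightarrow> (\<exists>a b c. l = lin a b c \<and> (a \<noteq> 0 \<or> b \<noteq> 0))"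
proof
  assume td: "total_degree l = 1"
  have "l \<in> Pi_space (Suc 0)"
    using Pi_space_total_degree[of l] td by simp
  moreover obtain r q where l: "l = pCons r q" by (cases l)
  ultimately have "degree r \<le> 1" "q \<in> Pi_space 0"
    using Pi_space_pCons_Suc by auto
  then obtain b where q: "q = [:[:b:]:]"
    using Pi_space_0_const by blast
  have "r = [:coeff r 0, coeff r 1:]"
    using \<open>degree r \<le> 1\<close> by (intro poly_eqI) (auto simp: coeff_pCons coeff_eq_0 split: nat.splits)
  then have "l = lin (coeff r 1) b (coeff r 0)"
    using l q by (simp add: lin_def)
  moreover have "coeff r 1 \<noteq> 0 \<or> b \<noteq> 0"
  proof (rule ccontr)
    assume "\<not> (coeff r 1 \<noteq> 0 \<or> b \<noteq> 0)"
    then have "l = [:[:coeff r 0:]:]"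
      using calculation by (simp add: lin_def)
    then have "l \<in> Pi_space 0" by simp
    then have "total_degree l \<le> 0"
      unfolding total_degree_def by (rule Least_le)
    then show False using td by simp
  qed
  ultimately show "\<exists>a b c. l = lin a b c \<and> (a \<noteq> 0 \<or> b \<noteq> 0)" by blast
next
  assume "\<exists>a b c. l = lin a b c \<and> (a \<noteq> 0 \<or> b \<noteq> 0)"
  then obtain a b c where l: "l = lin a b c" "a \<noteq> 0 \<or> b \<noteq> 0" by blast
  have "l \<notin> Pi_space 0"
    using l by (auto simp: lin_def Pi_space_pCons_0)
  then have "total_degree l \<noteq> 0"
    using Pi_space_total_degree[of l] by metis
  moreover have "total_degree l \<le> 1"
    unfolding total_degree_def l by (rule Least_le Pi_space_lin)+
  ultimately show "total_degree l = 1" by simp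
qed

lemma total_degree_1E:
  assumes "total_degree l = 1"
  obtains a b c where "l = lin a b c" "a \<noteq> 0 \<or> b \<noteq> 0"
  using assms unfolding total_degree_1_iff by blast

lemma is_lineE:
  assumes "is_line L"
  obtains a b c where "L = zero_set (lin a b c)" "a \<noteq> 0 \<or> b \<noteq> 0"
  using assms unfolding is_line_def by (metis total_degree_1E)

lemma total_degree_1_in_Pi_space: "total_degree l = 1 \<Longrightarrow> l \<in> Pi_space 1"
  using Pi_space_total_degree[of l] by simp

lemma infinite_line:
  assumes "is_line L"
  shows "infinite L"
proof -
  obtain a b c where ab: "a \<noteq> 0 \<or> b \<noteq> 0" and L: "L = zero_set (lin a b c)"
    using assms(1) by (rule is_lineE)
  define s where "s = a\<^sup>2 + b\<^sup>2"
  have s: "s \<noteq> 0"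
    using ab by (simp add: s_def sum_power2_eq_zero_iff)
  \<comment> \<open>The point \<open>(- a * u, - b * u)\<close> is the foot of the perpendicular
    from the origin, and \<open>(b, - a)\<close> is a direction of the line.\<close>
  define u where "u = c / s"
  define f where "f t = (t * b - a * u, - t * a - b * u)" for t
  have "inj f"
    using ab by (auto simp: f_def inj_def)
  have "c = u * (a\<^sup>2 + b\<^sup>2)"
    using s by (simp add: u_def s_def)
  then have "a * (t * b - a * u) + b * (- t * a - b * u) + c = 0" for t
    by (simp add: power2_eq_square algebra_simps)
  then have "range f \<subseteq> L"
    by (auto simp: f_def L zero_set_iff)
  moreover have "infinite (range f)"
    using \<open>inj f\<close> finite_imageD infinite_UNIV_char_0 by blast
  ultimately show ?thesis
    using finite_subset by blast
qed

lemma ex_line_through: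
  assumes "P \<noteq> Q"
  obtains L where "is_line L" "P \<in> L" "Q \<in> L"
proof -
  define a b where "a = snd P - snd Q" and "b = fst Q - fst P"
  have "a \<noteq> 0 \<or> b \<noteq> 0"
    using assms by (auto simp: a_def b_def prod_eq_iff)
  then have "is_line (zero_set (lin a b (- a * fst P - b * snd P)))"
    unfolding is_line_def total_degree_1_iff by blast
  moreover have "P \<in> zero_set (lin a b (- a * fst P - b * snd P))"
      "Q \<in> zero_set (lin a b (- a * fst P - b * snd P))"
    by (auto simp: zero_set_iff a_def b_def algebra_simps)
  ultimately show ?thesis by (rule that)
qed

lemma line_subset:
  assumes "is_line L" "is_line M" "P \<in> L" "Q \<in> L" "P \<in> M" "Q \<in> M" "P \<noteq> Q"
  shows "L \<subseteq> M"
proof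
  fix R assume "R \<in> L"
  obtain a b c where ab: "a \<noteq> 0 \<or> b \<noteq> 0" and L: "L = zero_set (lin a b c)"
    using assms(1) by (rule is_lineE)
  obtain a' b' c' where ab': "a' \<noteq> 0 \<or> b' \<noteq> 0" and M: "M = zero_set (lin a' b' c')"
    using assms(2) by (rule is_lineE)
  obtain px "py" qx qy rx ry where PQR: "P = (px, py)" "Q = (qx, qy)" "R = (rx, ry)"
    by (metis surj_pair)
  have e: "a * px + b * py + c = 0" "a * qx + b * qy + c = 0" "a * rx + b * ry + c = 0"
      "a' * px + b' * py + c' = 0" "a' * qx + b' * qy + c' = 0"
    using assms \<open>R \<in> L\<close> by (auto simp: L M zero_set_iff PQR)
  have ne: "px \<noteq> qx \<or> py \<noteq> qy"
    using assms PQR by auto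
  \<comment> \<open>The nonzero normal \<open>(a, b)\<close> annihilates both R - P and Q - P, so
    these vectors are parallel. Hence the second linear form at R is determined by its values at P
    and Q.\<close>
  have det: "(rx - px) * (qy - py) = (ry - py) * (qx - px)"
  proof -
    have 1: "a * (rx - px) + b * (ry - py) = 0" "a * (qx - px) + b * (qy - py) = 0"
      using e by (auto simp: algebra_simps)
    have "a * ((rx - px) * (qy - py) - (ry - py) * (qx - px)) = 0"
      using 1 by algebra
    moreover have "b * ((rx - px) * (qy - py) - (ry - py) * (qx - px)) = 0"
      using 1 by algebra
    ultimately show ?thesis using ab by auto
  qed
  have "(qx - px) * (a' * rx + b' * ry + c') = 0"
    using det e by algebra
  moreover have "(qy - py) * (a' * rx + b' * ry + c') = 0"
    using det e by algebra
  ultimately have "a' * rx + b' * ry + c' = 0"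
    using ne by auto
  then show "R \<in> M"
    by (simp add: M PQR zero_set_iff)
qed

lemma line_unique:
  assumes "is_line L" "is_line M" "P \<in> L" "Q \<in> L" "P \<in> M" "Q \<in> M" "P \<noteq> Q"
  shows "L = M"
  using line_subset[OF assms] line_subset[of M L P Q] assms by blast

lemma infinite_Int_lines:
  assumes "is_line L" "is_line M" "infinite (L \<inter> M)"
  shows "L = M"
proof -
  obtain P where "P \<in> L \<inter> M"
    using assms(3) by (metis ex_in_conv finite.emptyI)
  moreover have "infinite (L \<inter> M - {P})"
    using assms(3) by simp
  then obtain Q where "Q \<in> L \<inter> M - {P}"
    by (metis ex_in_conv finite.emptyI)
  ultimately show ?thesis
    using line_unique[OF assms(1,2), of P Q] by auto
qed

section \<open>Splitting off linear factors\<close>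

text \<open>Substituting an affine \<open>m\<close> for y cannot raise the total degree: in Horner's
  scheme each multiplication by \<open>m\<close> uses up one power of y.\<close>

lemma degree_poly_Pi_space:
  assumes "p \<in> Pi_space n" "degree m \<le> 1"
  shows "degree (poly p m) \<le> n"
  using assms(1)
proof (induction p arbitrary: n)
  case 0
  then show ?case by simp
next
  case (pCons a p)
  show ?case
  proof (cases n)
    case 0
    then show ?thesis
      using pCons.prems Pi_space_pCons_0 by auto
  next
    case (Suc k)
    then have a: "degree a \<le> Suc k" "p \<in> Pi_space k"
      using pCons.prems Pi_space_pCons_Suc by auto
    have "degree (m * poly p m) \<le> 1 + k"
      by (rule order_trans[OF degree_mult_le])
        (use pCons.IH[OF a(2)] assms(2) in linarith)
    then show ?thesis
      using a Suc by (auto intro!: degree_add_le)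
  qed
qed

text \<open>The coefficients of the quotient by y - m(x) are values at \<open>m\<close> of the tails
  of \<open>p\<close>, to which the previous degree bound applies.\<close>

lemma synthetic_div_Pi_space:
  assumes "p \<in> Pi_space (Suc n)" "degree m \<le> 1"
  shows "synthetic_div p m \<in> Pi_space n"
  using assms(1)
proof (induction p arbitrary: n)
  case 0
  then show ?case by simp
next
  case (pCons a p)
  then have p: "p \<in> Pi_space n"
    using Pi_space_pCons_Suc by auto
  show ?case
  proof (cases n)
    case 0
    obtain c where "p = [:[:c:]:]"
      using p 0 Pi_space_0_const by blast
    then show ?thesis
      by (simp add: synthetic_div_eq_0_iff[THEN iffD2])
  next
    case (Suc k)
    then have "synthetic_div p m \<in> Pi_space k"
      using pCons.IH p by simp
    then show ?thesis
      using degree_poly_Pi_space[OF p assms(2)] Suc by (simp add: Pi_space_pCons_Suc)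
  qed
qed

lemma poly_poly_eq_eval2: "poly (poly p m) x = eval2 p (x, poly m x)"
  by (induction p) (auto simp: eval2_def)

lemma poly_map_poly_eq_eval2: "poly (map_poly (\<lambda>r. poly r x) p) y = eval2 p (x, y)"
  by (induction p) (auto simp: eval2_def map_poly_pCons)

lemma poly_eq_0_if_card_roots:
  fixes r :: "'a :: {comm_ring_1,ring_no_zero_divisors} poly"
  assumes "card A > degree r" "\<And>x. x \<in> A \<Longrightarrow> poly r x = 0"
  shows "r = 0"
proof (rule ccontr)
  assume "r \<noteq> 0"
  have "card A \<le> card {x. poly r x = 0}"
    using assms(2) by (intro card_mono poly_roots_finite \<open>r \<noteq> 0\<close>) auto
  also have "\<dots> \<le> degree r"
    using \<open>r \<noteq> 0\<close> by (rule card_poly_roots_bound)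
  finally show False using assms(1) by simp
qed

lemma Pi_space_0_eq_0: "p \<in> Pi_space 0 \<Longrightarrow> eval2 p P = 0 \<Longrightarrow> p = 0"
  by (elim Pi_space_0_const) simp

text \<open>For a nonvertical line \<open>y = m(x)\<close>, divide by \<open>y - m\<close>; the remainder \<open>p(x, m(x))\<close>
  has degree at most \<open>n\<close> and more than \<open>n\<close> roots.\<close>

lemma line_factor:
  assumes l: "total_degree l = 1" and p: "p \<in> Pi_space (Suc n)"
    and K: "K \<subseteq> zero_set l" "K \<subseteq> zero_set p" "Suc n < card K"
  shows "\<exists>q\<in>Pi_space n. p = l * q"
proof -
  obtain a b c where ab: "a \<noteq> 0 \<or> b \<noteq> 0" and l: "l = lin a b c"
    using l by (rule total_degree_1E)
  show ?thesis
  proof (cases "b = 0")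
    case False
    define m where "m = [:- c / b, - a / b:]"
    have lm: "l = [:[:b:]:] * [:- m, 1:]"
      using False by (simp add: l lin_def m_def)
    have K_snd: "snd P = poly m (fst P)" if "P \<in> K" for P
    proof -
      have "a * fst P + b * snd P + c = 0"
        using K that by (auto simp: l zero_set_iff)
      moreover have "b * poly m (fst P) = - c - a * fst P"
        using False by (simp add: m_def field_simps)
      ultimately have "b * snd P = b * poly m (fst P)"
        by linarith
      then show ?thesis using False by simp
    qed
    have "inj_on fst K"
      using K_snd by (auto simp: inj_on_def prod_eq_iff)
    have m1: "degree m \<le> 1"
      by (simp add: m_def degree_pCons_le)
    have "degree (poly p m) < card (fst ` K)"
      using degree_poly_Pi_space[OF p m1] K \<open>inj_on fst K\<close> by (simp add: card_image)
    moreover have "poly (poly p m) x = 0" if "x \<in> fst ` K" for x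
    proof -
      obtain P where "P \<in> K" "x = fst P"
        using \<open>x \<in> fst ` K\<close> by blast
      then have "(x, poly m x) \<in> K"
        using K_snd by (metis prod.collapse)
      then show ?thesis
        using K by (auto simp: poly_poly_eq_eval2 zero_set_iff)
    qed
    ultimately have "poly p m = 0"
      by (rule poly_eq_0_if_card_roots)
    then have "p = [:- m, 1:] * synthetic_div p m"
      using synthetic_div_correct'[of m p] by simp
    also have "\<dots> = l * smult [:1 / b:] (synthetic_div p m)"
    proof -
      have "r * t = smult [:b:] r * smult [:1 / b:] t" for r t :: bipoly
        using False by (simp add: pCons_one)
      moreover have "l = smult [:b:] [:- m, 1:]"
        using lm by simp
      ultimately show ?thesis by metis
    qed
    finally show ?thesis
      using synthetic_div_Pi_space[OF p m1] Pi_space_smult by blast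
  next
    case True
    then have a: "a \<noteq> 0" using ab by simp
    define x where "x = - c / a"
    have K_fst: "fst P = x" if "P \<in> K" for P
    proof -
      have "a * fst P + c = 0"
        using K that True by (auto simp: l zero_set_iff dest!: subsetD)
      then have "a * fst P = - c" by linarith
      then show ?thesis
        using a by (simp add: x_def field_simps)
    qed
    have "inj_on snd K"
      using K_fst by (auto simp: inj_on_def prod_eq_iff)
    \<comment> \<open>On the vertical line, \<open>p\<close> restricts to the polynomial
      \<open>r\<close> in y of degree at most \<open>Suc n\<close> with more than
      \<open>Suc n\<close> roots. So \<open>r\<close> vanishes, and \<open>x\<close> is a root of
      every coefficient of \<open>p\<close>.\<close>
    define r where "r = map_poly (\<lambda>r. poly r x) p"
    have "degree r \<le> Suc n"
    proof (rule degree_le, safe)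
      fix j assume "Suc n < j"
      then have "coeff p j = 0"
        using p by (meson Pi_space_iff_degree add_leD2 leD)
      then show "coeff r j = 0"
        by (simp add: r_def coeff_map_poly)
    qed
    then have "degree r < card (snd ` K)"
      using K \<open>inj_on snd K\<close> by (simp add: card_image)
    moreover have "poly r y = 0" if "y \<in> snd ` K" for y
    proof -
      obtain P where "P \<in> K" "y = snd P"
        using \<open>y \<in> snd ` K\<close> by blast
      then have "(x, y) \<in> K"
        using K_fst by (metis prod.collapse)
      then show ?thesis
        using K by (auto simp: r_def poly_map_poly_eq_eval2 zero_set_iff)
    qed
    ultimately have "r = 0"
      by (rule poly_eq_0_if_card_roots)
    then have root: "poly (coeff p j) x = 0" for j
      by (metis coeff_0 coeff_map_poly poly_0 r_def)
    have "[:c, a:] = smult a [:- x, 1:]"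
      using a by (simp add: x_def)
    moreover have "smult a [:- x, 1:] dvd coeff p j" for j
      using root[of j] a by (intro smult_dvd) (simp_all add: poly_eq_0_iff_dvd)
    ultimately have "[:c, a:] dvd coeff p j" for j
      by metis
    then have "[:[:c, a:]:] dvd p"
      by (simp add: const_poly_dvd_iff)
    then obtain q where q: "p = [:[:c, a:]:] * q"
      by (elim dvdE)
    have "q \<in> Pi_space n"
      unfolding Pi_space_iff_degree
    proof safe
      fix j assume j: "coeff q j \<noteq> 0"
      have "coeff p j = [:c, a:] * coeff q j"
        by (simp add: q)
      moreover have "[:c, a:] \<noteq> 0" "degree [:c, a:] = 1"
        using a by simp_all
      ultimately have "coeff p j \<noteq> 0" "degree (coeff p j) = 1 + degree (coeff q j)"
        using j by (simp_all only: degree_mult_eq mult_eq_0_iff not_False_eq_True simp_thms)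
      then show "degree (coeff q j) + j \<le> n"
        using p by (force simp: Pi_space_iff_degree)
    qed
    then show ?thesis
      using q True by (auto simp: l lin_def)
  qed
qed

lemma total_degree_1_nonzero: "total_degree l = 1 \<Longrightarrow> l \<noteq> 0"
  by (elim total_degree_1E) (auto simp: lin_def)

lemma is_line_zero_set: "total_degree l = 1 \<Longrightarrow> is_line (zero_set l)"
  by (auto simp: is_line_def)

text \<open>Infinitely many common zeros exceed every degree bound, so \<open>line_factor\<close>
  applies. From here on divisibility is decided by point sets alone.\<close>

lemma line_dvd_if_infinite:
  assumes l: "total_degree l = 1" and inf: "infinite (zero_set l \<inter> zero_set p)"
  shows "l dvd p"
proof -
  obtain n where "p \<in> Pi_space n"
    using Pi_space_exists by blast
  then have "p \<in> Pi_space (Suc n)"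
    by (rule Pi_space_mono) simp
  moreover obtain K where "card K = n + 2" "K \<subseteq> zero_set l \<inter> zero_set p"
    using infinite_arbitrarily_large[OF inf] by blast
  ultimately show ?thesis
    using line_factor[OF l, of p n K] by fastforce
qed

lemma line_dvd_iff:
  assumes "total_degree l = 1"
  shows "l dvd p \<longleftrightarrow> zero_set l \<subseteq> zero_set p"
proof
  show "l dvd p \<Longrightarrow> zero_set l \<subseteq> zero_set p"
    by (auto simp: zero_set_iff)
  show "zero_set l \<subseteq> zero_set p \<Longrightarrow> l dvd p"
    using line_dvd_if_infinite[OF assms] infinite_line[OF is_line_zero_set[OF assms]]
    by (simp add: Int_absorb2)
qed

lemma zero_set_mult: "zero_set (p * q) = zero_set p \<union> zero_set q"
  by (auto simp: zero_set_def)

text \<open>Linear polynomials are prime for a geometric reason: if two zero sets cover an infinite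
  line, one of them contains infinitely many of its points.\<close>

lemma line_dvd_mult:
  assumes l: "total_degree l = 1" and dvd: "l dvd p * q"
  shows "l dvd p \<or> l dvd q"
proof -
  have "zero_set l = (zero_set l \<inter> zero_set p) \<union> (zero_set l \<inter> zero_set q)"
    using dvd unfolding line_dvd_iff[OF l] zero_set_mult by blast
  then have "infinite (zero_set l \<inter> zero_set p) \<or> infinite (zero_set l \<inter> zero_set q)"
    using infinite_line[OF is_line_zero_set[OF l]] by (metis finite_UnI)
  then show ?thesis
    using line_dvd_if_infinite[OF l] by blast
qed

text \<open>The quotient supplied by \<open>line_factor\<close> has the lower degree bound, and
  cancellation identifies it with \<open>q\<close>.\<close>

lemma line_cofactor_degree:
  assumes l: "total_degree l = 1" and lq: "l * q \<in> Pi_space n" and "q \<noteq> 0"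
  shows "n \<ge> 1" "q \<in> Pi_space (n - 1)"
proof -
  have inf: "infinite (zero_set l)"
    by (rule infinite_line[OF is_line_zero_set[OF l]])
  have sub: "zero_set l \<subseteq> zero_set (l * q)"
    by (auto simp: zero_set_iff)
  have "n \<noteq> 0"
  proof
    assume "n = 0"
    obtain P where "P \<in> zero_set l"
      using inf by (metis ex_in_conv finite.emptyI)
    then have "l * q = 0"
      using lq \<open>n = 0\<close> by (intro Pi_space_0_eq_0[of _ P]) (auto simp: zero_set_iff)
    then show False
      using \<open>q \<noteq> 0\<close> total_degree_1_nonzero[OF l] by simp
  qed
  then obtain m where n: "n = Suc m"
    by (cases n) auto
  obtain K where K: "card K = m + 2" "K \<subseteq> zero_set l"
    using infinite_arbitrarily_large[OF inf] by blast
  obtain r where "r \<in> Pi_space m" "l * q = l * r"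
    using line_factor[OF l, of "l * q" m K] lq K sub n by force
  then show "n \<ge> 1" "q \<in> Pi_space (n - 1)"
    using total_degree_1_nonzero[OF l] n by auto
qed

text \<open>Counting uses lines as point sets, divisibility uses polynomials. The chosen
  representative is determined up to a nonzero constant.\<close>

definition line_poly :: "point set \<Rightarrow> bipoly" where
  "line_poly L = (SOME l. total_degree l = 1 \<and> zero_set l = L)"

lemma line_poly:
  assumes "is_line L"
  shows "total_degree (line_poly L) = 1" "zero_set (line_poly L) = L"
proof -
  have "total_degree (line_poly L) = 1 \<and> zero_set (line_poly L) = L"
    unfolding line_poly_def by (rule someI_ex) (use assms in \<open>auto simp: is_line_def\<close>)
  then show "total_degree (line_poly L) = 1" "zero_set (line_poly L) = L" by auto
qed

lemma line_poly_nonzero: "is_line L \<Longrightarrow> line_poly L \<noteq> 0"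
  using line_poly(1) total_degree_1_nonzero by blast

lemma eval2_line_poly: "is_line L \<Longrightarrow> eval2 (line_poly L) P = 0 \<longleftrightarrow> P \<in> L"
  using line_poly(2) zero_set_iff by blast

lemma line_poly_dvd_line_poly:
  assumes "is_line L" "is_line M" "line_poly L dvd line_poly M"
  shows "L = M"
proof -
  have "L \<subseteq> M"
    using assms line_dvd_iff[of "line_poly L" "line_poly M"] line_poly by simp
  then show ?thesis
    using infinite_Int_lines[of L M] infinite_line[of L] assms by (simp add: Int_absorb2)
qed

text \<open>Lines are split off one at a time. A new line meets the earlier ones in finitely many
  points, so it still has infinitely many points on the zero set of the cofactor. Each line costs
  one degree, which bounds their number.\<close>

lemma prod_lines_dvd:
  assumes p: "p \<in> Pi_space n" "p \<noteq> 0" and S: "finite S"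
    and "\<And>L. L \<in> S \<Longrightarrow> is_line L" "\<And>L. L \<in> S \<Longrightarrow> infinite (L \<inter> zero_set p)"
  shows "card S \<le> n \<and> (\<exists>q\<in>Pi_space (n - card S). p = (\<Prod>L\<in>S. line_poly L) * q)"
  using S assms(4,5)
proof (induction S)
  case empty
  then show ?case using p by simp
next
  case (insert L S)
  then obtain q where q: "q \<in> Pi_space (n - card S)" "p = (\<Prod>L\<in>S. line_poly L) * q"
      and S: "card S \<le> n"
    by auto
  have L: "is_line L" "infinite (L \<inter> zero_set p)"
    using insert.prems by auto
  have "L \<inter> zero_set p \<subseteq> (\<Union>M\<in>S. L \<inter> M) \<union> (L \<inter> zero_set q)"
    using insert.prems insert.hyps
    by (auto simp: q(2) zero_set_iff eval2_prod eval2_line_poly)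
  moreover have "finite (\<Union>M\<in>S. L \<inter> M)"
    using insert.hyps insert.prems infinite_Int_lines[OF L(1)] by blast
  ultimately have "infinite (L \<inter> zero_set q)"
    using L(2) by (meson finite_UnI finite_subset)
  then have "line_poly L dvd q"
    using line_dvd_if_infinite[of "line_poly L" q] line_poly[OF L(1)] by simp
  then obtain r where r: "q = line_poly L * r"
    by (elim dvdE)
  have "r \<noteq> 0"
    using p q r by auto
  have "n - card S \<ge> 1" "r \<in> Pi_space (n - card S - 1)"
    using line_cofactor_degree[OF line_poly(1)[OF L(1)] _ \<open>r \<noteq> 0\<close>] q(1) r by blast+
  moreover have "p = (\<Prod>L\<in>insert L S. line_poly L) * r"
    using insert.hyps q(2) r by (simp add: mult_ac)
  ultimately show ?case
    using insert.hyps S by auto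
qed

text \<open>Here repeated factors count with multiplicity. The extra factor \<open>q\<close> makes
  room for the unit left over when a product of lines is factored.\<close>

lemma prod_list_lines_degree:
  assumes "prod_list ls * q \<in> Pi_space m" "q \<noteq> 0" "\<And>l. l \<in> set ls \<Longrightarrow> total_degree l = 1"
  shows "length ls \<le> m"
  using assms
proof (induction ls arbitrary: m)
  case (Cons l ls)
  have "prod_list ls \<noteq> 0"
    using Cons.prems(3) total_degree_1_nonzero by (auto simp: prod_list_zero_iff)
  then have "m \<ge> 1" "prod_list ls * q \<in> Pi_space (m - 1)"
    using line_cofactor_degree[of l "prod_list ls * q" m] Cons.prems by (auto simp: mult_ac)
  then show ?case
    using Cons.IH[of "m - 1"] Cons.prems by auto
qed simp

text \<open>Each line of the list is prime, so it can be cancelled from \<open>k\<close> or from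
  \<open>g\<close>; the ones cancelled from \<open>k\<close> form \<open>ks\<close>, and a unit
  remains.\<close>

lemma factor_of_prod_lines:
  assumes "prod_list ls = k * g" "\<And>l. l \<in> set ls \<Longrightarrow> total_degree l = 1"
  shows "\<exists>ks u. set ks \<subseteq> set ls \<and> u dvd 1 \<and> k = prod_list ks * u"
  using assms
proof (induction ls arbitrary: k g)
  case Nil
  then have "k dvd 1" by (metis dvdI prod_list.Nil)
  then show ?case by (intro exI[of _ "[]"] exI[of _ k]) auto
next
  case (Cons l ls)
  have l: "total_degree l = 1" "l \<noteq> 0"
    using Cons.prems total_degree_1_nonzero by auto
  have "l dvd k * g"
    using Cons.prems(1) by (metis dvd_triv_left prod_list.Cons)
  then consider (k) "l dvd k" | (g) "l dvd g"
    using line_dvd_mult[OF l(1)] by blast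
  then show ?case
  proof cases
    case k
    then obtain k' where k': "k = l * k'" by (elim dvdE)
    then have "prod_list ls = k' * g"
      using Cons.prems(1) l(2) by (simp add: mult.assoc)
    then obtain ks u where "set ks \<subseteq> set ls" "u dvd 1" "k' = prod_list ks * u"
      using Cons.IH Cons.prems(2) by (metis list.set_intros(2))
    then show ?thesis
      using k' by (intro exI[of _ "l # ks"] exI[of _ u]) (auto simp: mult_ac)
  next
    case g
    then obtain g' where g': "g = l * g'" by (elim dvdE)
    then have "l * prod_list ls = l * (k * g')"
      using Cons.prems(1) by (simp add: mult_ac)
    then have "prod_list ls = k * g'"
      using l(2) by simp
    then obtain ks u where "set ks \<subseteq> set ls" "u dvd 1" "k = prod_list ks * u"
      using Cons.IH Cons.prems(2) by (metis list.set_intros(2))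
    then show ?thesis
      by (intro exI[of _ ks] exI[of _ u]) auto
  qed
qed

text \<open>The conic is a member of the pencil spanned by \<open>L\<^sub>1 \<union> L\<^sub>2\<close> and the pair
  of lines \<open>A\<^sub>1A\<^sub>2\<close>, \<open>C\<^sub>1C\<^sub>2\<close>.\<close>

lemma conic_through_5_points:
  assumes L: "is_line L1" "is_line L2" "L1 \<noteq> L2"
    and "A1 \<in> L1" "C1 \<in> L1" "A1 \<notin> L2" "C1 \<notin> L2"
    and "A2 \<in> L2" "C2 \<in> L2" "A2 \<notin> L1" "C2 \<notin> L1"
    and "B \<notin> L1" "B \<notin> L2"
  obtains k where "k \<in> Pi_space 2" "k \<noteq> 0" "\<And>P. P \<in> {B, A1, C1, A2, C2} \<Longrightarrow> eval2 k P = 0"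
proof -
  obtain M where M: "is_line M" "A1 \<in> M" "A2 \<in> M"
    using ex_line_through assms by metis
  obtain N where N: "is_line N" "C1 \<in> N" "C2 \<in> N"
    using ex_line_through assms by metis
  define r s where "r = line_poly L1 * line_poly L2" and "s = line_poly M * line_poly N"
  \<comment> \<open>The coefficients are chosen to make \<open>k\<close> vanish at \<open>B\<close>;
    at the other four points both \<open>r\<close> and \<open>s\<close> vanish already.\<close>
  define k where "k = smult [:eval2 r B:] s - smult [:eval2 s B:] r"
  have deg: "line_poly K * line_poly K' \<in> Pi_space 2" if "is_line K" "is_line K'" for K K'
    using Pi_space_mult[of "line_poly K" 1 "line_poly K'" 1] that
      total_degree_1_in_Pi_space[OF line_poly(1)] by (simp add: numeral_2_eq_2)
  have "k \<in> Pi_space 2"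
    unfolding k_def r_def s_def using deg L M N by (intro Pi_space_diff Pi_space_smult) auto
  \<comment> \<open>To see that \<open>k\<close> is not zero, take a third point \<open>Q\<close> of
    \<open>L1\<close>: there \<open>r\<close> vanishes and \<open>s\<close> does not, and the
    coefficient of \<open>s\<close> is nonzero because \<open>B\<close> is on neither line.\<close>
  have "infinite (L1 - {A1, C1})"
    using infinite_line[OF L(1)] by simp
  then obtain Q where Q: "Q \<in> L1" "Q \<noteq> A1" "Q \<noteq> C1"
    by (metis Diff_iff ex_in_conv finite.emptyI insertCI)
  then have "Q \<notin> M" "Q \<notin> N"
    using line_unique[of L1 M A1 Q] line_unique[of L1 N C1 Q] L M N assms by metis+
  moreover have "eval2 r Q = 0"
    using L Q by (simp add: r_def eval2_line_poly)
  ultimately have "eval2 k Q \<noteq> 0"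
    using L M N assms by (simp add: k_def) (simp add: r_def s_def eval2_line_poly)
  then have "k \<noteq> 0" by auto
  moreover have "eval2 k P = 0" if "P \<in> {B, A1, C1, A2, C2}" for P
  proof (cases "P = B")
    case True
    then show ?thesis by (simp add: k_def)
  next
    case False
    then have "P \<in> L1 \<or> P \<in> L2" "P \<in> M \<or> P \<in> N"
      using that M N assms by blast+
    then have "eval2 r P = 0" "eval2 s P = 0"
      using L(1,2) M N by (simp_all add: r_def s_def eval2_line_poly)
    then show ?thesis by (simp add: k_def)
  qed
  ultimately show ?thesis
    using that \<open>k \<in> Pi_space 2\<close> by blast
qed

subsection \<open>Special triplets of a correct set\<close>

lemma n_correct_eq_0:
  assumes "n_correct n X" "p \<in> Pi_space n" "\<And>P. P \<in> X \<Longrightarrow> eval2 p P = 0"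
  shows "p = 0"
proof -
  have "\<exists>!p. p \<in> Pi_space n \<and> (\<forall>P\<in>X. eval2 p P = 0)"
    using assms(1)[unfolded n_correct_def] by (auto dest: spec[of _ "\<lambda>_. 0"])
  then show ?thesis
    using assms(2,3) by (metis Pi_space_zero eval2_simps(1))
qed

lemma fundamental_poly:
  assumes "n_correct n X" "A \<in> X"
  shows "fundamental_poly n X A \<in> Pi_space n" "eval2 (fundamental_poly n X A) A = 1"
    "\<And>P. P \<in> X \<Longrightarrow> P \<noteq> A \<Longrightarrow> eval2 (fundamental_poly n X A) P = 0"
proof -
  let ?Q = "\<lambda>p. p \<in> Pi_space n \<and> eval2 p A = 1 \<and> (\<forall>P\<in>X - {A}. eval2 p P = 0)"
  have "?Q p \<longleftrightarrow> p \<in> Pi_space n \<and> (\<forall>P\<in>X. eval2 p P = (if P = A then 1 else 0))" for p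
    using assms(2) by auto
  then have "\<exists>!p. ?Q p"
    using assms(1) by (simp add: n_correct_def)
  then have "?Q (fundamental_poly n X A)"
    unfolding fundamental_poly_def by (rule theI')
  then show "fundamental_poly n X A \<in> Pi_space n" "eval2 (fundamental_poly n X A) A = 1"
    "\<And>P. P \<in> X \<Longrightarrow> P \<noteq> A \<Longrightarrow> eval2 (fundamental_poly n X A) P = 0" by auto
qed

text \<open>The difference of the two sides vanishes on all of \<open>X\<close>. This is how
  products of curves are recognised as fundamental polynomials.\<close>

lemma eq_fundamental_poly:
  assumes "n_correct n X" "A \<in> X" "q \<in> Pi_space n" "\<And>P. P \<in> X \<Longrightarrow> P \<noteq> A \<Longrightarrow> eval2 q P = 0"
  shows "q = smult [:eval2 q A:] (fundamental_poly n X A)"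
proof -
  let ?p = "fundamental_poly n X A"
  have "q - smult [:eval2 q A:] ?p = 0"
  proof (rule n_correct_eq_0[OF assms(1)])
    show "q - smult [:eval2 q A:] ?p \<in> Pi_space n"
      by (intro Pi_space_diff Pi_space_smult assms fundamental_poly)
    show "eval2 (q - smult [:eval2 q A:] ?p) P = 0" if "P \<in> X" for P
      using that assms fundamental_poly[OF assms(1,2)] by (cases "P = A") auto
  qed
  then show ?thesis by simp
qed

text \<open>A special triplet without the node count of its curve: deriving that count from
  \<open>n\<close>-correctness would require the dimension of \<open>\<Pi>\<^sub>n\<close>.\<close>

definition triplet :: "nat \<Rightarrow> point set \<Rightarrow> point set \<Rightarrow> bool" where
  "triplet n X T \<longleftrightarrow> T \<subseteq> X \<and> card T = 3 \<and> (\<exists>f\<in>Pi_space (n - 1). X - zero_set f = T)"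

lemma special_triplet_imp_triplet: "special_triplet n X T \<Longrightarrow> triplet n X T"
  unfolding special_triplet_def triplet_def maximal_curve_def
  using Pi_space_total_degree by metis

locale pointed_correct_set =
  fixes n :: nat and X :: "point set" and B :: point
  assumes correct: "n_correct n X" and B: "B \<in> X" and n2: "n \<ge> 2"
begin

definition triplets :: "point set set" where
  "triplets = {T. triplet n X T \<and> B \<in> T}"

text \<open>The line opposite to \<open>B\<close> in the triangle \<open>T\<close>.\<close>

definition opp :: "point set \<Rightarrow> point set" where
  "opp T = (SOME L. is_line L \<and> T - {B} \<subseteq> L)"

abbreviation pB :: bipoly where
  "pB \<equiv> fundamental_poly n X B"

lemma finite_X: "finite X"
  using correct by (simp add: n_correct_def)

lemma triplet_subset: "T \<in> triplets \<Longrightarrow> T \<subseteq> X"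
  by (simp add: triplets_def triplet_def)

lemma finite_triplets: "finite triplets"
  by (rule finite_subset[of _ "Pow X"]) (use triplet_subset finite_X in auto)

lemma pB_nonzero: "pB \<noteq> 0"
  using fundamental_poly(2)[OF correct B] by auto

lemma card_triplet_minus: "T \<in> triplets \<Longrightarrow> card (T - {B}) = 2"
  by (simp add: triplets_def triplet_def card_Diff_singleton)

lemma tripletE:
  assumes "T \<in> triplets"
  obtains A C where "T = {B, A, C}" "A \<noteq> B" "C \<noteq> B" "A \<noteq> C"
proof -
  obtain A C where "T - {B} = {A, C}" "A \<noteq> C"
    using card_triplet_minus[OF assms] by (auto simp: card_2_iff)
  moreover have "B \<in> T"
    using assms by (simp add: triplets_def)
  ultimately show ?thesis
    using that[of A C] by blast
qed

text \<open>The curve contains the nodes outside \<open>T\<close>, the line contains the two nodes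
  of \<open>T\<close> other than \<open>B\<close>. Their product is therefore a multiple of
  \<open>pB\<close>, and a nonzero one, which also keeps \<open>B\<close> off the line. The constant
  is moved into \<open>f\<close>.\<close>

lemma
  assumes T: "T \<in> triplets"
  shows is_line_opp: "is_line (opp T)"
    and triplet_subset_opp: "T - {B} \<subseteq> opp T"
    and B_notin_opp: "B \<notin> opp T"
    and triplet_factor: "\<exists>f\<in>Pi_space (n - 1). pB = line_poly (opp T) * f \<and> X - zero_set f = T"
proof -
  obtain A C where AC: "T = {B, A, C}" "A \<noteq> B" "C \<noteq> B" "A \<noteq> C"
    using T by (rule tripletE)
  obtain L where "is_line L" "A \<in> L" "C \<in> L"
    using ex_line_through AC(4) by blast
  then have "is_line L \<and> T - {B} \<subseteq> L"
    using AC by auto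
  then have opp: "is_line (opp T) \<and> T - {B} \<subseteq> opp T"
    unfolding opp_def by (rule someI)
  obtain f where f: "f \<in> Pi_space (n - 1)" "X - zero_set f = T"
    using T by (auto simp: triplets_def triplet_def)
  let ?l = "line_poly (opp T)"
  define c where "c = eval2 (?l * f) B"
  have lf: "?l * f \<in> Pi_space n"
    using Pi_space_mult[OF total_degree_1_in_Pi_space[OF line_poly(1)] f(1), of "opp T"] opp n2
    by simp
  have "eval2 (?l * f) P = 0" if "P \<in> X" "P \<noteq> B" for P
  proof (cases "P \<in> T")
    case True
    then show ?thesis
      using opp that by (auto simp: eval2_line_poly)
  next
    case False
    then have "P \<in> zero_set f"
      using f(2) that by blast
    then show ?thesis
      by (simp add: zero_set_iff)
  qed
  then have eq: "?l * f = smult [:c:] pB"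
    unfolding c_def by (intro eq_fundamental_poly correct B lf)
  have fB: "eval2 f B \<noteq> 0"
    using f(2) AC by (auto simp: zero_set_iff)
  have "?l * f \<noteq> 0"
    using fB line_poly_nonzero opp by auto
  then have "c \<noteq> 0"
    using eq by auto
  show "is_line (opp T)" "T - {B} \<subseteq> opp T"
    using opp by auto
  show "B \<notin> opp T"
    using \<open>c \<noteq> 0\<close> opp by (auto simp: c_def eval2_line_poly)
  have "pB = ?l * smult [:1 / c:] f"
    using eq \<open>c \<noteq> 0\<close> by (simp add: pCons_one)
  moreover have "X - zero_set (smult [:1 / c:] f) = T"
    using f(2) \<open>c \<noteq> 0\<close> by (simp add: zero_set_def)
  ultimately show "\<exists>f\<in>Pi_space (n - 1). pB = ?l * f \<and> X - zero_set f = T"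
    using Pi_space_smult f(1) by blast
qed

text \<open>The line determines its cofactor in \<open>pB\<close>, and the triplet is the set of
  nodes off that cofactor.\<close>

lemma inj_on_opp: "inj_on opp triplets"
proof (rule inj_onI)
  fix T T' assume T: "T \<in> triplets" "T' \<in> triplets" "opp T = opp T'"
  obtain f where f: "pB = line_poly (opp T) * f" "X - zero_set f = T"
    using triplet_factor T by blast
  obtain f' where f': "pB = line_poly (opp T') * f'" "X - zero_set f' = T'"
    using triplet_factor T by blast
  have "line_poly (opp T) * f = line_poly (opp T) * f'"
    using f f' T(3) by metis
  then have "f = f'"
    using line_poly_nonzero[OF is_line_opp[OF T(1)]] by simp
  then show "T = T'"
    using f f' by simp
qed

lemma opp_subset_zero_set: "T \<in> triplets \<Longrightarrow> opp T \<subseteq> zero_set pB"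
  using triplet_factor[of T] is_line_opp[of T] by (auto simp: zero_set_iff eval2_line_poly)

text \<open>Distinct triplets give distinct linear factors of \<open>pB\<close>, whose degree is at
  most \<open>n\<close>; hence the bound on the number of triplets.\<close>

lemma pB_eq_prod:
  "card triplets \<le> n \<and> (\<exists>q\<in>Pi_space (n - card triplets). pB = (\<Prod>T\<in>triplets. line_poly (opp T)) * q)"
proof -
  have "card (opp ` triplets) \<le> n \<and>
    (\<exists>q\<in>Pi_space (n - card (opp ` triplets)). pB = (\<Prod>L\<in>opp ` triplets. line_poly L) * q)"
  proof (rule prod_lines_dvd)
    fix L assume "L \<in> opp ` triplets"
    then show "is_line L" "infinite (L \<inter> zero_set pB)"
      using is_line_opp opp_subset_zero_set infinite_line by (auto simp: Int_absorb2)
  qed (use fundamental_poly(1)[OF correct B] pB_nonzero finite_triplets in auto)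
  then show ?thesis
    using inj_on_opp by (simp add: card_image prod.reindex)
qed

section \<open>Mutual position of the opposite lines\<close>

text \<open>Exchanging the two opposite lines in \<open>pB\<close> for a conic through the five
  points of \<open>T1 \<union> T2\<close> gives the fundamental polynomial of their intersection.
  The factors are kept in the conclusion: \<open>g\<close> serves to exclude concurrent lines,
  \<open>k\<close> to find collinear points.\<close>

lemma two_triplets:
  assumes T: "T1 \<in> triplets" "T2 \<in> triplets" "T1 \<noteq> T2"
  obtains D g k where "D \<in> X" "D \<in> opp T1" "D \<in> opp T2"
    "pB = line_poly (opp T1) * (line_poly (opp T2) * g)" "k \<in> Pi_space 2"
    "\<And>P. P \<in> T1 \<union> T2 \<Longrightarrow> eval2 k P = 0" "fundamental_poly n X D = k * g"
    "T1 \<inter> opp T2 = {}" "T2 \<inter> opp T1 = {}"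
proof -
  let ?L1 = "opp T1" and ?L2 = "opp T2"
  let ?l1 = "line_poly ?L1" and ?l2 = "line_poly ?L2"
  have L: "is_line ?L1" "is_line ?L2" "?L1 \<noteq> ?L2"
    using T is_line_opp inj_on_opp by (auto simp: inj_on_def)
  obtain f1 where f1: "f1 \<in> Pi_space (n - 1)" "pB = ?l1 * f1" "X - zero_set f1 = T1"
    using triplet_factor T by blast
  obtain f2 where f2: "pB = ?l2 * f2" "X - zero_set f2 = T2"
    using triplet_factor T by blast
  have "?l2 dvd f1"
    using line_dvd_mult[OF line_poly(1)[OF L(2)], of ?l1 f1] f1(2) f2(1)
      line_poly_dvd_line_poly[OF L(2,1)] L(3) by (metis dvd_triv_left)
  then obtain g where g1: "f1 = ?l2 * g" by (elim dvdE)
  then have "?l2 * f2 = ?l2 * (?l1 * g)"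
    using f1(2) f2(1) by (simp add: mult_ac)
  then have g2: "f2 = ?l1 * g"
    using line_poly_nonzero[OF L(2)] by simp
  have pB: "pB = ?l1 * (?l2 * g)"
    using f1(2) g1 by simp
  have "g \<noteq> 0"
    using pB pB_nonzero by auto
  have g: "g \<in> Pi_space (n - 2)"
    using line_cofactor_degree(2)[OF line_poly(1)[OF L(2)], of g "n - 1"] f1(1) g1 \<open>g \<noteq> 0\<close>
    by (simp add: numeral_2_eq_2)
  \<comment> \<open>The curve of each triplet has the other opposite line as a factor and does not
    vanish on its own triplet.\<close>
  have disj: "T1 \<inter> ?L2 = {}" "T2 \<inter> ?L1 = {}"
  proof -
    have "eval2 f1 P \<noteq> 0" if "P \<in> T1" for P
      using that f1(3) by (auto simp: zero_set_iff)
    then show "T1 \<inter> ?L2 = {}"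
      using g1 eval2_line_poly[OF L(2)] by auto
    have "eval2 f2 P \<noteq> 0" if "P \<in> T2" for P
      using that f2(2) by (auto simp: zero_set_iff)
    then show "T2 \<inter> ?L1 = {}"
      using g2 eval2_line_poly[OF L(1)] by auto
  qed
  obtain A1 C1 where T1: "T1 = {B, A1, C1}" "A1 \<noteq> B" "C1 \<noteq> B" "A1 \<noteq> C1"
    using T(1) by (rule tripletE)
  obtain A2 C2 where T2: "T2 = {B, A2, C2}" "A2 \<noteq> B" "C2 \<noteq> B" "A2 \<noteq> C2"
    using T(2) by (rule tripletE)
  obtain k where k: "k \<in> Pi_space 2" "k \<noteq> 0"
      and k0: "\<And>P. P \<in> {B, A1, C1, A2, C2} \<Longrightarrow> eval2 k P = 0"
  proof (rule conic_through_5_points[of ?L1 ?L2 A1 C1 A2 C2 B])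
    show "A1 \<in> ?L1" "C1 \<in> ?L1" "A2 \<in> ?L2" "C2 \<in> ?L2"
      using triplet_subset_opp[OF T(1)] triplet_subset_opp[OF T(2)] T1 T2 by auto
    show "A1 \<notin> ?L2" "C1 \<notin> ?L2" "A2 \<notin> ?L1" "C2 \<notin> ?L1" "B \<notin> ?L1" "B \<notin> ?L2"
      using disj T1 T2 by auto
  qed (use L T1 T2 in auto)
  have kg: "k * g \<in> Pi_space n"
    using Pi_space_mult[OF k(1) g] by (simp only: le_add_diff_inverse[OF n2])
  \<comment> \<open>A node off both triplets is a zero of \<open>f1\<close> and of
    \<open>f2\<close>, that is, of \<open>g\<close> times each of the two line polynomials. If
    \<open>g\<close> is nonzero there, the node is on both lines.\<close>
  have on_lines: "P \<in> ?L1 \<inter> ?L2" if P: "P \<in> X" "eval2 (k * g) P \<noteq> 0" for P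
  proof -
    have kP: "P \<notin> T1 \<union> T2"
      using P(2) k0[of P] by (auto simp: T1(1) T2(1))
    then have "eval2 f1 P = 0" "eval2 f2 P = 0"
      using f1(3) f2(2) P(1) by (auto simp: zero_set_iff)
    then show ?thesis
      using g1 g2 P(2) L by (simp add: eval2_line_poly)
  qed
  \<comment> \<open>A nonzero polynomial in \<open>Pi_space n\<close> cannot vanish at all nodes;
    this is what makes the intersection point a node.\<close>
  have "k * g \<noteq> 0"
    using k(2) \<open>g \<noteq> 0\<close> by simp
  then obtain D where D: "D \<in> X" "eval2 (k * g) D \<noteq> 0"
    using n_correct_eq_0[OF correct kg] by blast
  then have D12: "D \<in> ?L1 \<inter> ?L2"
    by (rule on_lines)
  define c where "c = eval2 (k * g) D"
  have "k * g = smult [:c:] (fundamental_poly n X D)"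
    unfolding c_def
  proof (rule eq_fundamental_poly[OF correct D(1) kg])
    fix P assume "P \<in> X" "P \<noteq> D"
    then show "eval2 (k * g) P = 0"
      using on_lines[of P] D12 line_unique[of ?L1 ?L2 P D] L by blast
  qed
  moreover have "c \<noteq> 0"
    using D(2) by (simp only: c_def not_False_eq_True)
  ultimately have "fundamental_poly n X D = smult [:1 / c:] k * g"
    by (simp add: pCons_one)
  moreover have "smult [:1 / c:] k \<in> Pi_space 2"
    using k(1) by (rule Pi_space_smult)
  moreover have "eval2 (smult [:1 / c:] k) P = 0" if "P \<in> T1 \<union> T2" for P
    using k0[of P] that by (auto simp: T1(1) T2(1))
  ultimately show ?thesis
    using that D(1) D12 pB disj by blast
qed

lemma opp_Int_triplet: "T \<in> triplets \<Longrightarrow> T' \<in> triplets \<Longrightarrow> T \<noteq> T' \<Longrightarrow> T \<inter> opp T' = {}"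
  using two_triplets by metis

lemma opp_Int_opp:
  assumes "T1 \<in> triplets" "T2 \<in> triplets" "T1 \<noteq> T2"
  obtains D where "D \<in> X" "opp T1 \<inter> opp T2 = {D}"
proof -
  obtain D where D: "D \<in> X" "D \<in> opp T1" "D \<in> opp T2"
    using two_triplets[OF assms] by metis
  have "opp T1 \<noteq> opp T2"
    using assms inj_on_opp by (auto simp: inj_on_def)
  then have "opp T1 \<inter> opp T2 = {D}"
    using D line_unique[of "opp T1" "opp T2" D] is_line_opp assms by blast
  then show ?thesis
    using that D by blast
qed

text \<open>The polynomial of a third line would divide \<open>g\<close>, and then the fundamental
  polynomial of the common point \<open>D\<close> would vanish at \<open>D\<close>.\<close>

lemma opp_not_concurrent:
  assumes T: "T1 \<in> triplets" "T2 \<in> triplets" "T3 \<in> triplets" "T1 \<noteq> T2" "T1 \<noteq> T3" "T2 \<noteq> T3"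
  shows "opp T1 \<inter> opp T2 \<inter> opp T3 = {}"
proof (rule ccontr)
  assume "\<not> ?thesis"
  then obtain P where P: "P \<in> opp T1" "P \<in> opp T2" "P \<in> opp T3" by blast
  obtain D g k where D: "D \<in> X" "D \<in> opp T1" "D \<in> opp T2"
    and pB: "pB = line_poly (opp T1) * (line_poly (opp T2) * g)"
    and kg: "fundamental_poly n X D = k * g"
    using two_triplets[OF T(1,2,4)] by metis
  have L: "is_line (opp T1)" "is_line (opp T2)" "is_line (opp T3)"
    using T is_line_opp by auto
  have ne: "opp T1 \<noteq> opp T2" "opp T1 \<noteq> opp T3" "opp T2 \<noteq> opp T3"
    using T inj_on_opp by (auto simp: inj_on_def)
  have "P = D"
    using line_unique[OF L(1,2), of P D] P D ne by blast
  have l3: "total_degree (line_poly (opp T3)) = 1"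
    using L line_poly by blast
  have "line_poly (opp T3) dvd pB"
    using triplet_factor[OF T(3)] by auto
  then have "line_poly (opp T3) dvd g"
    using line_dvd_mult[OF l3] line_poly_dvd_line_poly L ne unfolding pB by metis
  then have "eval2 g D = 0"
    using P(3) \<open>P = D\<close> L(3) by (auto simp: eval2_line_poly)
  then show False
    using kg fundamental_poly(2)[OF correct D(1)] by simp
qed

lemma card_triplets_le: "card triplets \<le> n"
  using pB_eq_prod by blast

section \<open>The extremal case of n triplets\<close>

lemma full_prod:
  assumes full: "card triplets = n"
  obtains c where "c \<noteq> 0" "pB = (\<Prod>T\<in>triplets. line_poly (opp T)) * [:[:c:]:]"
proof -
  obtain q where q: "q \<in> Pi_space 0" "pB = (\<Prod>T\<in>triplets. line_poly (opp T)) * q"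
    using pB_eq_prod full by auto
  obtain c where c: "q = [:[:c:]:]"
    using q(1) by (rule Pi_space_0_const)
  have "c \<noteq> 0"
    using pB_nonzero q(2) c by auto
  then show ?thesis
    using that q(2) c by metis
qed

lemma full_zero_set:
  assumes full: "card triplets = n"
  shows "zero_set pB = (\<Union>T\<in>triplets. opp T)"
proof -
  obtain c where c: "c \<noteq> 0" "pB = (\<Prod>T\<in>triplets. line_poly (opp T)) * [:[:c:]:]"
    using full by (rule full_prod)
  have "eval2 pB P = 0 \<longleftrightarrow> (\<exists>T\<in>triplets. P \<in> opp T)" for P
    unfolding c(2) eval2_simps eval2_prod
    using c(1) finite_triplets is_line_opp by (auto simp: eval2_line_poly)
  then show ?thesis
    by (auto simp: zero_set_iff)
qed

lemma full_node_on_line: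
  assumes full: "card triplets = n" and "P \<in> X" "P \<noteq> B"
  obtains T where "T \<in> triplets" "P \<in> opp T"
proof -
  have "P \<in> zero_set pB"
    using fundamental_poly(3)[OF correct B] assms by (simp add: zero_set_iff)
  then show ?thesis
    using that full_zero_set[OF full] by blast
qed

text \<open>Up to a constant, the curve of \<open>T\<close> is the product of the other opposite
  lines, and it passes through every node outside \<open>T\<close>.\<close>

lemma full_node_on_two_lines:
  assumes full: "card triplets = n" and T: "T \<in> triplets" and P: "P \<in> X" "P \<in> opp T" "P \<notin> T"
  obtains T' where "T' \<in> triplets" "T' \<noteq> T" "P \<in> opp T'"
proof -
  obtain f where f: "pB = line_poly (opp T) * f" "X - zero_set f = T"
    using triplet_factor T by blast
  obtain c where c: "c \<noteq> 0" "pB = (\<Prod>T\<in>triplets. line_poly (opp T)) * [:[:c:]:]"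
    using full by (rule full_prod)
  let ?Q = "\<Prod>T\<in>triplets - {T}. line_poly (opp T)"
  have "line_poly (opp T) * f = line_poly (opp T) * (?Q * [:[:c:]:])"
    using f(1) unfolding c(2) prod.remove[OF finite_triplets T] mult.assoc by (rule sym)
  then have feq: "f = ?Q * [:[:c:]:]"
    using line_poly_nonzero[OF is_line_opp[OF T]] mult_left_cancel by blast
  have "eval2 f P = 0"
    using P f(2) by (auto simp: zero_set_iff)
  then have "\<exists>T'\<in>triplets - {T}. P \<in> opp T'"
    unfolding feq eval2_simps eval2_prod
    using c(1) finite_triplets is_line_opp by (auto simp: eval2_line_poly)
  then show ?thesis
    using that by blast
qed

text \<open>The count is 2 + (n - 1). The crossing nodes are distinct because no three opposite
  lines concur, and they are not in \<open>T\<close> because \<open>T\<close> avoids the other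
  lines.\<close>

lemma full_maximal_opp:
  assumes full: "card triplets = n" and T: "T \<in> triplets"
  shows "maximal_line n X (opp T)"
proof -
  have "\<exists>D. D \<in> X \<and> opp T \<inter> opp T' = {D}" if "T' \<in> triplets - {T}" for T'
    using opp_Int_opp[of T T'] that T by (metis DiffE singletonI)
  then obtain D where D: "\<And>T'. T' \<in> triplets - {T} \<Longrightarrow> D T' \<in> X \<and> opp T \<inter> opp T' = {D T'}"
    by metis
  have inj: "inj_on D (triplets - {T})"
  proof (rule inj_onI, rule ccontr)
    fix T1 T2 assume *: "T1 \<in> triplets - {T}" "T2 \<in> triplets - {T}" "D T1 = D T2" "T1 \<noteq> T2"
    have "opp T \<inter> opp T1 \<inter> opp T2 = {}"
      using * T by (intro opp_not_concurrent) auto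
    then show False
      using D[OF *(1)] D[OF *(2)] *(3) by blast
  qed
  have eq: "opp T \<inter> X = (T - {B}) \<union> D ` (triplets - {T})"
  proof (rule Set.equalityI; rule subsetI)
    fix P assume P: "P \<in> opp T \<inter> X"
    show "P \<in> (T - {B}) \<union> D ` (triplets - {T})"
    proof (cases "P \<in> T")
      case True
      then show ?thesis
        using B_notin_opp[OF T] P by blast
    next
      case False
      then obtain T' where "T' \<in> triplets" "T' \<noteq> T" "P \<in> opp T'"
        using full_node_on_two_lines[OF full T] P by blast
      then show ?thesis
        using D[of T'] P by blast
    qed
  next
    fix P assume "P \<in> (T - {B}) \<union> D ` (triplets - {T})"
    then show "P \<in> opp T \<inter> X"
      using triplet_subset_opp[OF T] triplet_subset[OF T] D by blast
  qed
  have disj: "(T - {B}) \<inter> D ` (triplets - {T}) = {}"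
  proof -
    have "D T' \<notin> T" if "T' \<in> triplets - {T}" for T'
      using opp_Int_triplet[of T T'] that T D[OF that] by blast
    then show ?thesis by blast
  qed
  have "card (D ` (triplets - {T})) = n - 1"
    using T full by (simp add: card_image[OF inj] card_Diff_singleton)
  moreover have "finite (T - {B})"
    using triplet_subset[OF T] finite_X finite_subset by blast
  ultimately have "card (opp T \<inter> X) = n + 1"
    unfolding eq using card_Un_disjoint[OF _ _ disj] finite_triplets card_triplet_minus[OF T] n2
    by simp
  then show ?thesis
    using is_line_opp[OF T] by (simp add: maximal_line_def node_line_def)
qed

text \<open>A maximal line missing \<open>B\<close> carries \<open>n + 1\<close> zeros of
  \<open>pB\<close>, hence divides it. A line covered by finitely many lines is one of them.\<close>

lemma full_maximal_lines:
  assumes full: "card triplets = n"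
  shows "{L. maximal_line n X L \<and> B \<notin> L} = opp ` triplets"
proof (rule Set.equalityI; rule subsetI)
  fix L assume "L \<in> {L. maximal_line n X L \<and> B \<notin> L}"
  then have L: "is_line L" "card (L \<inter> X) = n + 1" "B \<notin> L"
    by (auto simp: maximal_line_def node_line_def)
  obtain m where m: "n = Suc m"
    using n2 by (cases n) auto
  have "\<exists>q\<in>Pi_space m. pB = line_poly L * q"
  proof (rule line_factor[OF line_poly(1)[OF L(1)]])
    show "pB \<in> Pi_space (Suc m)"
      using fundamental_poly(1)[OF correct B] m by simp
    show "L \<inter> X \<subseteq> zero_set (line_poly L)"
      using line_poly(2)[OF L(1)] by blast
    show "L \<inter> X \<subseteq> zero_set pB"
    proof
      fix P assume "P \<in> L \<inter> X"
      moreover from this have "P \<noteq> B"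
        using L(3) by blast
      ultimately show "P \<in> zero_set pB"
        using fundamental_poly(3)[OF correct B] by (simp add: zero_set_iff)
    qed
    show "Suc m < card (L \<inter> X)"
      using L(2) m by simp
  qed
  then have "L \<subseteq> (\<Union>T\<in>triplets. opp T)"
    unfolding full_zero_set[OF full, symmetric]
    using L(1) by (auto simp: zero_set_iff eval2_line_poly)
  then have "L = (\<Union>T\<in>triplets. L \<inter> opp T)"
    by blast
  then obtain T where "T \<in> triplets" "infinite (L \<inter> opp T)"
    using infinite_line[OF L(1)] finite_triplets by (metis (no_types, lifting) finite_UN)
  then show "L \<in> opp ` triplets"
    using infinite_Int_lines[OF L(1), of "opp T"] is_line_opp by blast
next
  fix L assume "L \<in> opp ` triplets"
  then show "L \<in> {L. maximal_line n X L \<and> B \<notin> L}"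
    using full_maximal_opp[OF full] B_notin_opp by blast
qed

end

subsection \<open>Used 2-node lines of a GC set\<close>

text \<open>A form symmetric in the indices. A one-point intersection also shows that the two
  infinite lines differ, and a point \<open>A i\<close> on no other line is not a crossing
  point.\<close>

lemma Carnicer_Gasca_setI:
  assumes "\<And>i. i \<le> n \<Longrightarrow> is_line (l i)"
    and "\<And>i j. i \<le> n \<Longrightarrow> j \<le> n \<Longrightarrow> i \<noteq> j \<Longrightarrow> \<exists>P\<in>X. l i \<inter> l j = {P}"
    and "\<And>i j k. i < j \<Longrightarrow> j < k \<Longrightarrow> k \<le> n \<Longrightarrow> l i \<inter> l j \<inter> l k = {}"
    and "\<And>i. i \<le> n \<Longrightarrow> A i \<in> l i \<inter> X"
    and "\<And>i j. i \<le> n \<Longrightarrow> j \<le> n \<Longrightarrow> i \<noteq> j \<Longrightarrow> A i \<notin> l j"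
    and "\<not> (\<exists>L. is_line L \<and> A ` {..n} \<subseteq> L)"
    and X: "\<And>P. P \<in> X \<Longrightarrow> (\<exists>i\<le>n. P = A i) \<or> (\<exists>i\<le>n. \<exists>j\<le>n. i \<noteq> j \<and> P \<in> l i \<inter> l j)"
  shows "Carnicer_Gasca_set n X"
  unfolding Carnicer_Gasca_set_def
proof (intro exI[of _ l] exI[of _ A] conjI allI impI)
  let ?I = "{P. \<exists>i j. i < j \<and> j \<le> n \<and> P \<in> l i \<inter> l j}"
  show "X = ?I \<union> A ` {..n}"
  proof (rule Set.equalityI; rule subsetI)
    fix P assume "P \<in> X"
    then consider (A) i where "i \<le> n" "P = A i"
      | (I) i j where "i \<le> n" "j \<le> n" "i \<noteq> j" "P \<in> l i \<inter> l j"
      using X by blast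
    then show "P \<in> ?I \<union> A ` {..n}"
    proof cases
      case I
      then have "P \<in> ?I"
        by (cases i j rule: linorder_cases) auto
      then show ?thesis by blast
    qed auto
  next
    fix P assume "P \<in> ?I \<union> A ` {..n}"
    then consider (A) i where "i \<le> n" "P = A i"
      | (I) i j where "i < j" "j \<le> n" "P \<in> l i \<inter> l j"
      by blast
    then show "P \<in> X"
    proof cases
      case A
      then show ?thesis using assms(4) by blast
    next
      case I
      then obtain Q where "Q \<in> X" "l i \<inter> l j = {Q}"
        using assms(2)[of i j] by auto
      then show ?thesis using I(3) by (metis singletonD)
    qed
  qed
  fix i j assume ij: "i < j \<and> j \<le> n"
  then obtain Q where Q: "l i \<inter> l j = {Q}"
    using assms(2)[of i j] by auto
  then show "l i \<inter> l j \<noteq> {}" by blast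
  have "infinite (l i)"
    using infinite_line assms(1) ij by simp
  then show "l i \<noteq> l j"
    using Q by force
next
  fix i assume i: "i \<le> n"
  show "A i \<notin> {P. \<exists>i j. i < j \<and> j \<le> n \<and> P \<in> l i \<inter> l j}"
  proof
    assume "A i \<in> {P. \<exists>i j. i < j \<and> j \<le> n \<and> P \<in> l i \<inter> l j}"
    then obtain j k where "j < k" "k \<le> n" "A i \<in> l j" "A i \<in> l k" by blast
    then show False
      using assms(5)[of i j] assms(5)[of i k] i by (cases "i = j") auto
  qed
qed (use assms in auto)

locale pointed_GC_set = pointed_correct_set +
  assumes GC: "GC_set n X" and n3: "n \<ge> 3"
begin

text \<open>With \<open>D = opp T1 \<inter> opp T2\<close>, the conic factor of the fundamental polynomial of \<open>D\<close>
  passes through the five points of \<open>T1 \<union> T2\<close>. It splits into two lines missing \<open>D\<close>, and each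
  of them meets \<open>T1 - {B}\<close> and \<open>T2 - {B}\<close> in one point.\<close>

lemma triplets_collinear:
  assumes T: "T1 \<in> triplets" "T2 \<in> triplets" "T1 \<noteq> T2"
  obtains M P1 P2 where "is_line M" "B \<in> M" "P1 \<in> M" "P2 \<in> M" "P1 \<in> T1 - {B}" "P2 \<in> T2 - {B}"
proof -
  obtain D g k where D: "D \<in> X" "D \<in> opp T1" "D \<in> opp T2"
    and k: "k \<in> Pi_space 2" "\<And>P. P \<in> T1 \<union> T2 \<Longrightarrow> eval2 k P = 0"
    and kg: "fundamental_poly n X D = k * g"
    by (rule two_triplets[OF T]) blast
  obtain ls where ls: "\<And>l. l \<in> set ls \<Longrightarrow> total_degree l = 1" "prod_list ls = k * g"
    using GC D(1) kg unfolding GC_set_def by metis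
  obtain ks u where ks: "set ks \<subseteq> set ls" "u dvd 1" "k = prod_list ks * u"
    using factor_of_prod_lines[OF ls(2,1)] by blast
  obtain v where v: "1 = u * v"
    using ks(2) by (elim dvdE)
  \<comment> \<open>A unit has no zeros, so every zero of \<open>k\<close> lies on one of the lines
    in \<open>ks\<close>.\<close>
  have u: "eval2 u P \<noteq> 0" for P
    using arg_cong[OF v, of "\<lambda>p. eval2 p P"] by auto
  then have "u \<noteq> 0"
    by (metis eval2_simps(1))
  have ks1: "\<And>l. l \<in> set ks \<Longrightarrow> total_degree l = 1"
    using ks(1) ls(1) by blast
  have "length ks \<le> 2"
    using prod_list_lines_degree[OF _ \<open>u \<noteq> 0\<close>] k(1) ks(3) ks1 by blast
  then have card_ks: "card (set ks) \<le> 2"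
    using card_length order_trans by blast
  have zero: "eval2 (prod_list xs) P = 0 \<Longrightarrow> \<exists>l\<in>set xs. P \<in> zero_set l" for xs P
    by (induction xs) (auto simp: zero_set_iff)
  have cover: "\<exists>l\<in>set ks. P \<in> zero_set l" if "P \<in> T1 \<union> T2" for P
    using k(2)[OF that] u[of P] by (intro zero) (simp add: ks(3))
  have "D \<notin> zero_set l" if "l \<in> set ks" for l
  proof
    assume "D \<in> zero_set l"
    moreover have "l dvd fundamental_poly n X D"
      using that ks(1) ls(2) kg by (metis prod_list_dvd subsetD)
    ultimately have "eval2 (fundamental_poly n X D) D = 0"
      by (auto simp: zero_set_iff)
    then show False
      using fundamental_poly(2)[OF correct D(1)] by simp
  qed
  then have ne_opp: "zero_set l \<noteq> opp T1" "zero_set l \<noteq> opp T2" if "l \<in> set ks" for l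
    using D that by blast+
  \<comment> \<open>A line of \<open>ks\<close> containing both points of \<open>T' - {B}\<close>
    would be \<open>opp T'\<close>, which passes through \<open>D\<close>. So the two points need
    different lines, and these are all the lines of \<open>ks\<close>.\<close>
  have two_lines: "\<exists>l l' A C. T' - {B} = {A, C} \<and> set ks = {l, l'} \<and> A \<in> zero_set l \<and> C \<in> zero_set l'"
    if T': "T' \<in> {T1, T2}" for T'
  proof -
    have T't: "T' \<in> triplets"
      using T' T by blast
    then obtain A C where AC: "T' = {B, A, C}" "A \<noteq> B" "C \<noteq> B" "A \<noteq> C"
      by (rule tripletE)
    obtain l where l: "l \<in> set ks" "A \<in> zero_set l"
      using cover[of A] AC T' by blast
    obtain l' where l': "l' \<in> set ks" "C \<in> zero_set l'"
      using cover[of C] AC T' by blast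
    have "l \<noteq> l'"
    proof
      assume "l = l'"
      have "zero_set l = opp T'"
        by (rule line_unique[of _ _ A C])
          (use is_line_zero_set[OF ks1[OF l(1)]] is_line_opp[OF T't] triplet_subset_opp[OF T't]
            AC l l' \<open>l = l'\<close> in auto)
      then show False
        using ne_opp[OF l(1)] T' by blast
    qed
    then have "set ks = {l, l'}"
      using card_seteq[of "set ks" "{l, l'}"] l l' card_ks by auto
    then show ?thesis
      using AC l l' by (intro exI[of _ l] exI[of _ l'] exI[of _ A] exI[of _ C]) auto
  qed
  obtain m where m: "m \<in> set ks" "B \<in> zero_set m"
    using cover[of B] T(1) by (auto simp: triplets_def)
  have hit: "\<exists>P\<in>T' - {B}. P \<in> zero_set m" if "T' \<in> {T1, T2}" for T'
    using two_lines[OF that] m(1) by (elim exE conjE) (metis insertE insertI1 insertI2 singletonD)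
  obtain P1 where "P1 \<in> T1 - {B}" "P1 \<in> zero_set m"
    using hit[of T1] by blast
  moreover obtain P2 where "P2 \<in> T2 - {B}" "P2 \<in> zero_set m"
    using hit[of T2] by blast
  ultimately show ?thesis
    using that is_line_zero_set[OF ks1[OF m(1)]] m(2) by blast
qed

section \<open>Used 2-node lines and their triplets\<close>

definition used_lines :: "point set set" where
  "used_lines = {L. node_line X 2 L \<and> used_line n X L \<and> B \<in> L}"

lemma used_lineD:
  assumes "L \<in> used_lines"
  shows "is_line L" "card (L \<inter> X) = 2" "B \<in> L"
  using assms by (auto simp: used_lines_def node_line_def)

text \<open>A node \<open>A\<close> using the line joins the two nodes on it to form a triplet; the
  curve is the cofactor of the line in the fundamental polynomial of \<open>A\<close>.\<close>

lemma used_line_triplet: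
  assumes L: "L \<in> used_lines"
  shows "\<exists>T\<in>triplets. L \<inter> X \<subseteq> T"
proof -
  obtain A l where A: "A \<in> X" and l: "total_degree l = 1" "L = zero_set l"
      and "l dvd fundamental_poly n X A"
    using L by (auto simp: used_lines_def used_line_def uses_line_def)
  then obtain f where f: "fundamental_poly n X A = l * f"
    by (elim dvdE)
  note fA = fundamental_poly[OF correct A]
  have "f \<noteq> 0"
    using f fA(2) by auto
  have fdeg: "f \<in> Pi_space (n - 1)"
    using line_cofactor_degree(2)[OF l(1) _ \<open>f \<noteq> 0\<close>] f fA(1) by simp
  have "A \<notin> L" "eval2 f A \<noteq> 0"
    using fA(2) f l(2) by (auto simp: zero_set_iff)
  have f0: "eval2 f P = 0" if "P \<in> X" "P \<noteq> A" "P \<notin> L" for P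
    using fA(3)[OF that(1,2)] that(3) by (auto simp: f l(2) zero_set_iff)
  have pair: "\<exists>Q. L \<inter> X = {P, Q}" if "P \<in> L \<inter> X" for P
  proof -
    obtain x y where "L \<inter> X = {x, y}"
      using used_lineD(2)[OF L] by (auto simp: card_2_iff)
    then show ?thesis
      using that by (metis insertE insert_commute singletonD)
  qed
  have f1: "eval2 f P \<noteq> 0" if "P \<in> L \<inter> X" for P
  proof
    assume "eval2 f P = 0"
    obtain Q where Q: "L \<inter> X = {P, Q}"
      using pair[OF \<open>P \<in> L \<inter> X\<close>] by blast
    have "A \<noteq> Q"
      using Q \<open>A \<notin> L\<close> by blast
    \<comment> \<open>If \<open>f\<close> vanished at \<open>P\<close>, its product with the line
      through \<open>A\<close> and \<open>Q\<close> would vanish at every node, the only zeros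
      missing from \<open>f\<close> being \<open>A\<close> and possibly \<open>Q\<close>.\<close>
    then obtain M where M: "is_line M" "A \<in> M" "Q \<in> M"
      by (rule ex_line_through)
    have "line_poly M * f \<in> Pi_space n"
      using Pi_space_mult[OF total_degree_1_in_Pi_space[OF line_poly(1)[OF M(1)]] fdeg] n2 by simp
    moreover have "eval2 (line_poly M * f) R = 0" if "R \<in> X" for R
    proof -
      have "R = A \<or> R = P \<or> R = Q \<or> R \<noteq> A \<and> R \<notin> L"
        using Q that by blast
      then show ?thesis
        using f0[OF that] \<open>eval2 f P = 0\<close> M by (auto simp: eval2_line_poly)
    qed
    ultimately have "line_poly M * f = 0"
      by (rule n_correct_eq_0[OF correct])
    then show False
      using \<open>f \<noteq> 0\<close> line_poly_nonzero[OF M(1)] by simp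
  qed
  let ?T = "insert A (L \<inter> X)"
  have "card ?T = 3"
    using used_lineD(2)[OF L] \<open>A \<notin> L\<close> finite_X by simp
  moreover have "P \<in> X - zero_set f \<longleftrightarrow> P \<in> ?T" for P
    using f0[of P] f1[of P] \<open>eval2 f A \<noteq> 0\<close> A by (auto simp: zero_set_iff)
  then have "X - zero_set f = ?T" by blast
  ultimately have "triplet n X ?T"
    using A fdeg by (auto simp: triplet_def)
  then have "?T \<in> triplets"
    using used_lineD(3)[OF L] B by (auto simp: triplets_def)
  then show ?thesis by blast
qed

text \<open>Otherwise the 2-node line would be \<open>M\<close>, which carries the three nodes
  \<open>B\<close>, \<open>P1\<close> and \<open>P2\<close>.\<close>

lemma used_line_avoids:
  assumes L: "L \<in> used_lines" and T: "T1 \<in> triplets" "T2 \<in> triplets" "T1 \<noteq> T2"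
    and M: "is_line M" "B \<in> M" "P1 \<in> M" "P2 \<in> M" "P1 \<in> T1 - {B}" "P2 \<in> T2 - {B}"
  shows "P1 \<notin> L"
proof
  assume "P1 \<in> L"
  then have "L = M"
    using line_unique[of L M B P1] used_lineD[OF L] M by blast
  have "P2 \<in> opp T2"
    using triplet_subset_opp[OF T(2)] M(6) by blast
  then have "P1 \<noteq> P2"
    using opp_Int_triplet[OF T] M(5) by blast
  have "{B, P1, P2} \<subseteq> L \<inter> X"
    using M \<open>L = M\<close> B triplet_subset[OF T(1)] triplet_subset[OF T(2)] by blast
  moreover have "card {B, P1, P2} = 3"
    using M(5,6) \<open>P1 \<noteq> P2\<close> by auto
  ultimately have "3 \<le> card (L \<inter> X)"
    using card_mono[of "L \<inter> X" "{B, P1, P2}"] finite_X by simp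
  then show False
    using used_lineD(2)[OF L] by simp
qed

text \<open>The point of \<open>T\<close> collinear with \<open>B\<close> and a point of
  \<open>T'\<close> lies on no used 2-node line. This leaves only the line through \<open>B\<close>
  and \<open>C\<close> for \<open>T\<close>.\<close>

lemma triplet_unused_point:
  assumes T: "T \<in> triplets" "T' \<in> triplets" "T \<noteq> T'"
  obtains A C where "T = {B, A, C}" "A \<noteq> B" "C \<noteq> B" "A \<noteq> C" "\<And>L. L \<in> used_lines \<Longrightarrow> A \<notin> L"
proof -
  obtain M P P' where M: "is_line M" "B \<in> M" "P \<in> M" "P' \<in> M" "P \<in> T - {B}" "P' \<in> T' - {B}"
    using T by (rule triplets_collinear)
  obtain A C where AC: "T = {B, A, C}" "A \<noteq> B" "C \<noteq> B" "A \<noteq> C"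
    using T(1) by (rule tripletE)
  have "P \<notin> L" if "L \<in> used_lines" for L
    using used_line_avoids[OF that T M] .
  moreover have "P = A \<or> P = C"
    using M(5) AC by blast
  ultimately show ?thesis
    using that[of A C] that[of C A] AC by blast
qed

definition triplet_of :: "point set \<Rightarrow> point set" where
  "triplet_of L = (SOME T. T \<in> triplets \<and> L \<inter> X \<subseteq> T)"

lemma triplet_of:
  assumes "L \<in> used_lines"
  shows "triplet_of L \<in> triplets" "L \<inter> X \<subseteq> triplet_of L"
  using someI_ex[of "\<lambda>T. T \<in> triplets \<and> L \<inter> X \<subseteq> T"] used_line_triplet[OF assms]
  unfolding triplet_of_def by blast+

lemma used_line_nodes:
  assumes L: "L \<in> used_lines" and "L \<inter> X \<subseteq> {B, A, C}" "A \<notin> L"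
  shows "L \<inter> X = {B, C}"
proof -
  have "L \<inter> X \<subseteq> {B, C}"
    using assms by blast
  moreover have "card {B, C} \<le> 2"
    by (simp add: card_insert_if)
  ultimately show ?thesis
    using card_seteq[of "{B, C}" "L \<inter> X"] used_lineD(2)[OF L] by simp
qed

lemma used_line_eq:
  assumes "L \<in> used_lines" "L' \<in> used_lines" "L \<inter> X = L' \<inter> X"
  shows "L = L'"
proof -
  obtain P Q where "L \<inter> X = {P, Q}" "P \<noteq> Q"
    using used_lineD(2)[OF assms(1)] by (auto simp: card_2_iff)
  then show ?thesis
    using line_unique[of L L' P Q] assms used_lineD by blast
qed

lemma inj_on_triplet_of:
  assumes "card triplets \<ge> 2"
  shows "inj_on triplet_of used_lines"
proof (rule inj_onI)
  fix L L' assume L: "L \<in> used_lines" "L' \<in> used_lines" "triplet_of L = triplet_of L'"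
  let ?T = "triplet_of L"
  have "triplets \<noteq> {?T}"
    using assms by auto
  then obtain T' where "T' \<in> triplets" "?T \<noteq> T'"
    using triplet_of(1)[OF L(1)] by blast
  then obtain A C where "?T = {B, A, C}" and A: "\<And>L. L \<in> used_lines \<Longrightarrow> A \<notin> L"
    by (rule triplet_unused_point[OF triplet_of(1)[OF L(1)]]) blast
  then have "L \<inter> X = {B, C}" "L' \<inter> X = {B, C}"
    using used_line_nodes triplet_of(2) L by metis+
  then show "L = L'"
    using used_line_eq L by simp
qed

lemma finite_used_lines: "finite used_lines"
proof (rule finite_imageD)
  show "finite ((\<lambda>L. L \<inter> X) ` used_lines)"
    by (rule finite_subset[of _ "Pow X"]) (use finite_X in auto)
  show "inj_on (\<lambda>L. L \<inter> X) used_lines"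
    by (rule inj_onI) (rule used_line_eq)
qed

lemma card_used_lines_le:
  assumes "card triplets \<ge> 2"
  shows "card used_lines \<le> card triplets"
  using card_inj_on_le[OF inj_on_triplet_of[OF assms] _ finite_triplets] triplet_of(1) by blast

text \<open>Without a second triplet both other nodes of a triplet may lie on used lines, but there
  are only two of them. Since \<open>n \<ge> 3\<close>, this case also stays away from the extremal
  one.\<close>

lemma card_used_lines_le_2:
  assumes "\<not> card triplets \<ge> 2"
  shows "card used_lines \<le> 2"
proof (cases "used_lines = {}")
  case False
  then obtain L0 where L0: "L0 \<in> used_lines" by blast
  let ?T = "triplet_of L0"
  have T: "?T \<in> triplets"
    using triplet_of(1)[OF L0] .
  have "card triplets \<le> 1"
    using assms by simp
  then have all: "triplet_of L = ?T" if "L \<in> used_lines" for L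
    using card_le_Suc0_iff_eq[OF finite_triplets] triplet_of(1)[OF that] T by simp
  obtain A C where AC: "?T = {B, A, C}" "A \<noteq> B" "C \<noteq> B" "A \<noteq> C"
    using T by (rule tripletE)
  have "L \<inter> X \<in> {{B, A}, {B, C}}" if L: "L \<in> used_lines" for L
  proof -
    have sub: "L \<inter> X \<subseteq> {B, A, C}"
      using triplet_of(2)[OF L] all[OF L] AC by simp
    have "\<not> {B, A, C} \<subseteq> L \<inter> X"
      using card_mono[of "L \<inter> X" "{B, A, C}"] finite_X used_lineD(2)[OF L] AC by auto
    moreover have "{B, A, C} \<subseteq> X"
      using triplet_subset[OF T] AC by simp
    ultimately have "A \<notin> L \<or> C \<notin> L"
      using used_lineD(3)[OF L] by blast
    then show ?thesis
    proof
      assume "A \<notin> L"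
      then show ?thesis
        using used_line_nodes[OF L, of A C] sub by simp
    next
      assume "C \<notin> L"
      then show ?thesis
        using used_line_nodes[OF L, of C A] sub by (simp add: insert_commute)
    qed
  qed
  then have "(\<lambda>L. L \<inter> X) ` used_lines \<subseteq> {{B, A}, {B, C}}"
    by blast
  moreover have "inj_on (\<lambda>L. L \<inter> X) used_lines"
    by (rule inj_onI) (rule used_line_eq)
  ultimately have "card used_lines \<le> card {{B, A}, {B, C}}"
    using card_inj_on_le by blast
  also have "\<dots> \<le> 2"
    by (simp add: card_insert_if)
  finally show ?thesis .
qed simp

lemma card_used_lines: "card used_lines \<le> n"
  using card_used_lines_le card_used_lines_le_2 card_triplets_le n3 by linarith

section \<open>The extremal case of n used 2-node lines\<close>

context
  assumes full_used: "card used_lines = n"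
begin

lemma full: "card triplets = n"
  using card_used_lines_le card_used_lines_le_2 card_triplets_le n3 full_used by linarith

text \<open>The injection \<open>triplet_of\<close> goes between sets of the same size
  \<open>n\<close>, so every triplet is attained.\<close>

lemma ex_used_line:
  assumes "T \<in> triplets"
  shows "\<exists>L\<in>used_lines. L \<inter> X \<subseteq> T"
proof -
  have inj: "inj_on triplet_of used_lines"
    using full n3 by (intro inj_on_triplet_of) simp
  have "triplet_of ` used_lines = triplets"
    by (rule card_seteq[OF finite_triplets])
      (use triplet_of(1) card_image[OF inj] full full_used in auto)
  then obtain L where "L \<in> used_lines" "T = triplet_of L"
    using assms by blast
  then show ?thesis
    using triplet_of(2) by blast
qed

lemma ex_other_triplet:
  assumes "T \<in> triplets"
  obtains T' where "T' \<in> triplets" "T' \<noteq> T"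
proof -
  have "triplets \<noteq> {T}"
    using full n3 by auto
  then show ?thesis
    using that assms by blast
qed

text \<open>In each triplet \<open>c T\<close> is the node on its used line and \<open>a T\<close>
  the node on none. Any two of the points \<open>a T\<close> are collinear with \<open>B\<close>, so
  all lie on the line \<open>M\<close> joining \<open>B\<close> to one of them.\<close>

lemma ex_labelling:
  obtains a c M where
    "\<And>T. T \<in> triplets \<Longrightarrow> T = {B, a T, c T} \<and> a T \<noteq> B \<and> c T \<noteq> B \<and> a T \<noteq> c T"
    "\<And>T. T \<in> triplets \<Longrightarrow> \<exists>L. is_line L \<and> L \<inter> X = {B, c T}"
    "is_line M" "B \<in> M" "\<And>T. T \<in> triplets \<Longrightarrow> a T \<in> M"
proof -
  have "\<exists>A C. T = {B, A, C} \<and> A \<noteq> B \<and> C \<noteq> B \<and> A \<noteq> C \<and> (\<forall>L\<in>used_lines. A \<notin> L)"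
    if T: "T \<in> triplets" for T
  proof -
    obtain T' where "T' \<in> triplets" "T' \<noteq> T"
      using ex_other_triplet[OF T] .
    then show ?thesis
      using triplet_unused_point[OF T, of T'] by metis
  qed
  then obtain a c where ac: "\<And>T. T \<in> triplets \<Longrightarrow> T = {B, a T, c T} \<and> a T \<noteq> B \<and> c T \<noteq> B \<and>
      a T \<noteq> c T \<and> (\<forall>L\<in>used_lines. a T \<notin> L)"
    by metis
  have L: "\<exists>L\<in>used_lines. L \<inter> X = {B, c T}" if T: "T \<in> triplets" for T
  proof -
    obtain L where L: "L \<in> used_lines" "L \<inter> X \<subseteq> T"
      using ex_used_line[OF T] by blast
    have "L \<inter> X \<subseteq> {B, a T, c T}"
      using L(2) ac[OF T] by metis
    then show ?thesis
      using used_line_nodes[OF L(1), of "a T" "c T"] ac[OF T] L(1) by metis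
  qed
  \<comment> \<open>The collinear points found for two triplets avoid all used lines, which
    \<open>c T\<close> does not; so they are \<open>a T\<close> and \<open>a T'\<close>.\<close>
  have pick: "P = a T" if T: "T \<in> triplets" "P \<in> T - {B}" "\<And>L. L \<in> used_lines \<Longrightarrow> P \<notin> L" for T P
  proof -
    have "P \<noteq> c T"
      using L[OF T(1)] T(3) by blast
    then show ?thesis
      using T(2) ac[OF T(1)] by blast
  qed
  have coll: "\<exists>M. is_line M \<and> B \<in> M \<and> a T \<in> M \<and> a T' \<in> M"
    if T: "T \<in> triplets" "T' \<in> triplets" "T \<noteq> T'" for T T'
  proof -
    obtain M P P' where M: "is_line M" "B \<in> M" "P \<in> M" "P' \<in> M" "P \<in> T - {B}" "P' \<in> T' - {B}"
      using T by (rule triplets_collinear)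
    have "P = a T"
      using used_line_avoids[OF _ T M] M(5) T(1) by (intro pick)
    moreover have "P' = a T'"
      using used_line_avoids[OF _ T(2,1) T(3)[symmetric] M(1,2,4,3,6,5)] M(6) T(2) by (intro pick)
    ultimately show ?thesis
      using M by blast
  qed
  have "triplets \<noteq> {}"
    using full n3 by auto
  then obtain T0 where T0: "T0 \<in> triplets" by blast
  have "B \<noteq> a T0"
    using ac[OF T0] by metis
  then obtain M where M: "is_line M" "B \<in> M" "a T0 \<in> M"
    by (rule ex_line_through)
  have "a T \<in> M" if T: "T \<in> triplets" for T
  proof (cases "T = T0")
    case False
    then obtain N where N: "is_line N" "B \<in> N" "a T0 \<in> N" "a T \<in> N"
      using coll[OF T0 T] by blast
    then show ?thesis
      using line_unique[OF N(1) M(1), of B "a T0"] M N \<open>B \<noteq> a T0\<close> by blast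
  qed (use M in simp)
  then show ?thesis
    using that[of a c M] ac L used_lineD(1) M by metis
qed

lemma full_structure:
  "card {L. maximal_line n X L} = n + 1 \<and> card {L. maximal_line n X L \<and> B \<notin> L} = n \<and>
   card {L. maximal_line n X L \<and> B \<in> L} = 1 \<and> Carnicer_Gasca_set n X"
proof -
  obtain a c M where
    ac: "\<And>T. T \<in> triplets \<Longrightarrow> T = {B, a T, c T} \<and> a T \<noteq> B \<and> c T \<noteq> B \<and> a T \<noteq> c T"
    and cL: "\<And>T. T \<in> triplets \<Longrightarrow> \<exists>L. is_line L \<and> L \<inter> X = {B, c T}"
    and M: "is_line M" "B \<in> M" "\<And>T. T \<in> triplets \<Longrightarrow> a T \<in> M"
    by (rule ex_labelling) (rule that)
  have mem: "a T \<in> opp T" "c T \<in> opp T" "a T \<in> X" "c T \<in> X" "a T \<in> T" "c T \<in> T"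
    if "T \<in> triplets" for T
    using ac[OF that] triplet_subset_opp[OF that] triplet_subset[OF that] by blast+
  have own: "a T \<notin> opp T'" "c T \<notin> opp T'" if "T \<in> triplets" "T' \<in> triplets" "T \<noteq> T'" for T T'
    using opp_Int_triplet[OF that] mem that by blast+
  have M_opp: "opp T \<inter> M = {a T}" if "T \<in> triplets" for T
    using line_unique[OF is_line_opp[OF that] M(1)] B_notin_opp[OF that] M mem[OF that] that by blast
  have c_notin_M: "c T \<notin> M" if "T \<in> triplets" for T
    using M_opp[OF that] mem(2)[OF that] ac[OF that] by (metis IntI singletonD)
  have inj_a: "inj_on a triplets" and inj_c: "inj_on c triplets"
    using own mem by (auto intro!: inj_onI) metis+

  \<comment> \<open>A node of \<open>M\<close> other than \<open>B\<close> lies on some opposite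
    line, and that line meets \<open>M\<close> only in \<open>a T\<close>.\<close>
  have M_X: "M \<inter> X = insert B (a ` triplets)"
  proof (rule Set.equalityI; rule subsetI)
    fix P assume P: "P \<in> M \<inter> X"
    show "P \<in> insert B (a ` triplets)"
    proof (cases "P = B")
      case False
      then obtain T where "T \<in> triplets" "P \<in> opp T"
        using full_node_on_line[OF full] P by blast
      then show ?thesis
        using M_opp P by blast
    qed simp
  qed (use M mem B in blast)
  have "B \<notin> a ` triplets"
    using ac by fastforce
  then have "card (M \<inter> X) = n + 1"
    using finite_triplets inj_a full by (simp add: M_X card_image)
  then have max_M: "maximal_line n X M"
    using M by (simp add: maximal_line_def node_line_def)

  \<comment> \<open>The \<open>n\<close> nodes other than \<open>B\<close> on a second maximal line
    \<open>L\<close> through \<open>B\<close> correspond to the \<open>n\<close> opposite lines, one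
    node on each. None lies on two of them, so the node on \<open>opp T\<close> is in
    \<open>T\<close>; it is not on \<open>M\<close>, hence is \<open>c T\<close>. But the line
    through \<open>B\<close> and \<open>c T\<close> has only two nodes.\<close>
  have M_unique: "L = M" if L: "maximal_line n X L" "B \<in> L" for L
  proof (rule ccontr)
    assume "L \<noteq> M"
    have L1: "is_line L" "card (L \<inter> X) = n + 1"
      using L by (auto simp: maximal_line_def node_line_def)
    let ?N = "L \<inter> X - {B}"
    have "\<forall>P\<in>?N. \<exists>T. T \<in> triplets \<and> P \<in> opp T"
      using full_node_on_line[OF full] by blast
    then obtain t where t: "\<And>P. P \<in> ?N \<Longrightarrow> t P \<in> triplets \<and> P \<in> opp (t P)"
      by metis
    have meet: "P = Q" if "T \<in> triplets" "P \<in> L" "P \<in> opp T" "Q \<in> L" "Q \<in> opp T" for P Q T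
      using line_unique[OF L1(1) is_line_opp[OF that(1)]] that B_notin_opp[OF that(1)] L(2) by blast
    have inj: "inj_on t ?N"
    proof (rule inj_onI)
      fix P Q assume "P \<in> ?N" "Q \<in> ?N" "t P = t Q"
      then show "P = Q"
        using t[of P] t[of Q] by (intro meet[of "t P"]) auto
    qed
    have "card ?N = n"
      using L1(2) L(2) B by (simp add: card_Diff_singleton)
    then have surj: "t ` ?N = triplets"
      using t by (intro card_seteq[OF finite_triplets]) (auto simp: card_image[OF inj] full)
    have "c T \<in> L" if T: "T \<in> triplets" for T
    proof -
      obtain P where P: "P \<in> ?N" "t P = T"
        using T unfolding surj[symmetric] by (elim imageE) metis
      have "P \<in> T"
      proof (rule ccontr)
        assume "P \<notin> T"
        then obtain T' where T': "T' \<in> triplets" "T' \<noteq> T" "P \<in> opp T'"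
          using full_node_on_two_lines[OF full T] P t by blast
        obtain Q where Q: "Q \<in> ?N" "t Q = T'"
          using T'(1) unfolding surj[symmetric] by (elim imageE) metis
        have "P = Q"
          using t[OF Q(1)] Q P T' by (intro meet[of T']) auto
        then show False
          using P Q T' by simp
      qed
      then have "P = a T \<or> P = c T"
        using P ac[OF T] by blast
      moreover have "P \<noteq> a T"
        using line_unique[OF L1(1) M(1), of B "a T"] P L(2) M T ac[OF T] \<open>L \<noteq> M\<close> by blast
      ultimately show ?thesis
        using P by blast
    qed
    moreover have "triplets \<noteq> {}"
      using full n3 by auto
    ultimately obtain T where T: "T \<in> triplets" "c T \<in> L" by blast
    obtain L' where L': "is_line L'" "L' \<inter> X = {B, c T}"
      using cL[OF T(1)] by blast
    have "L = L'"
      using line_unique[OF L1(1) L'(1), of B "c T"] L(2) L' T ac[OF T(1)] by blast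
    moreover have "card {B, c T} \<le> 2"
      by (simp add: card_insert_if)
    ultimately show False
      using L1(2) L'(2) n3 by simp
  qed

  have card_off: "card {L. maximal_line n X L \<and> B \<notin> L} = n"
    using full_maximal_lines[OF full] card_image[OF inj_on_opp] full by simp
  have through: "{L. maximal_line n X L \<and> B \<in> L} = {M}"
    using max_M M M_unique by blast
  have "{L. maximal_line n X L} = insert M {L. maximal_line n X L \<and> B \<notin> L}"
    using through by blast
  moreover have "finite {L. maximal_line n X L \<and> B \<notin> L}"
    using card_off n3 by (intro card_ge_0_finite) simp
  ultimately have card_all: "card {L. maximal_line n X L} = n + 1"
    using card_off M(2) by simp

  obtain h where h: "bij_betw h {..<n} triplets"
    using ex_bij_betw_nat_finite[OF finite_triplets] full by (auto simp: atLeast0LessThan)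
  have hT: "h i \<in> triplets" if "i < n" for i
    using h that by (auto simp: bij_betw_def)
  have h_ne: "h i \<noteq> h j" if "i < n" "j < n" "i \<noteq> j" for i j
    using h that by (auto simp: bij_betw_def inj_on_def)
  have h_surj: "\<exists>i<n. T = h i" if "T \<in> triplets" for T
    using h that by (auto simp: bij_betw_def)
  \<comment> \<open>The opposite lines get the indices below \<open>n\<close> and \<open>M\<close>
    gets the index \<open>n\<close>. The extra points are \<open>c T\<close> on \<open>opp T\<close>
    and \<open>B\<close> on \<open>M\<close>.\<close>
  define l where "l i = (if i < n then opp (h i) else M)" for i
  define A where "A i = (if i < n then c (h i) else B)" for i
  have "Carnicer_Gasca_set n X"
  proof (rule Carnicer_Gasca_setI[of n l X A])
    show "is_line (l i)" if "i \<le> n" for i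
      using that is_line_opp hT M by (simp add: l_def)
    show "\<exists>P\<in>X. l i \<inter> l j = {P}" if ij: "i \<le> n" "j \<le> n" "i \<noteq> j" for i j
    proof -
      consider "i < n" "j < n" | "i < n" "j = n" | "i = n" "j < n"
        using ij by linarith
      then show ?thesis
      proof cases
        case 1
        then show ?thesis
          using opp_Int_opp[of "h i" "h j"] hT h_ne[of i j] ij by (auto simp: l_def)
      next
        case 2
        then show ?thesis
          using M_opp hT mem by (auto simp: l_def)
      next
        case 3
        then show ?thesis
          using M_opp hT mem by (auto simp: l_def Int_commute)
      qed
    qed
    show "l i \<inter> l j \<inter> l k = {}" if "i < j" "j < k" "k \<le> n" for i j k
    proof (cases "k < n")
      case True
      then show ?thesis
        using that opp_not_concurrent hT h_ne by (simp add: l_def)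
    next
      case False
      have ij: "h i \<in> triplets" "h j \<in> triplets" "h i \<noteq> h j"
        using that hT h_ne[of i j] by auto
      \<comment> \<open>\<open>M\<close> meets \<open>opp (h i)\<close> only in
        \<open>a (h i)\<close>, which is on no other opposite line.\<close>
      have "opp (h i) \<inter> opp (h j) \<inter> M = opp (h j) \<inter> {a (h i)}"
        unfolding M_opp[OF ij(1), symmetric] by blast
      then have "opp (h i) \<inter> opp (h j) \<inter> M = {}"
        using own(1)[OF ij] by simp
      then show ?thesis
        using that False by (simp add: l_def)
    qed
    show "A i \<in> l i \<inter> X" if "i \<le> n" for i
      using that mem hT M B by (simp add: l_def A_def)
    show "A i \<notin> l j" if ij: "i \<le> n" "j \<le> n" "i \<noteq> j" for i j
    proof -
      consider "i < n" "j < n" | "i < n" "j = n" | "i = n" "j < n"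
        using ij by linarith
      then show ?thesis
        using own hT h_ne[of i j] ij c_notin_M B_notin_opp by cases (auto simp: l_def A_def)
    qed
    show "\<not> (\<exists>L. is_line L \<and> A ` {..n} \<subseteq> L)"
    proof
      assume "\<exists>L. is_line L \<and> A ` {..n} \<subseteq> L"
      then obtain L where L: "is_line L" "\<And>i. i \<le> n \<Longrightarrow> A i \<in> L" by blast
      \<comment> \<open>A line through all extra points would join \<open>B\<close> to
        \<open>c (h 0)\<close>; that line contains no third node, in particular not
        \<open>c (h 1)\<close>.\<close>
      have BL: "B \<in> L"
        using L(2)[of n] by (simp add: A_def)
      have T: "h 0 \<in> triplets" "h 1 \<in> triplets" "h 0 \<noteq> h 1" "c (h 0) \<in> L" "c (h 1) \<in> L"
        using L(2)[of 0] L(2)[of 1] hT h_ne[of 0 1] n3 by (auto simp: A_def)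
      obtain L' where L': "is_line L'" "L' \<inter> X = {B, c (h 0)}"
        using cL[OF T(1)] by blast
      have "L = L'"
        using line_unique[OF L(1) L'(1), of B "c (h 0)"] BL L'(2) T ac[OF T(1)] by blast
      then have "c (h 1) \<in> {B, c (h 0)}"
        using L' T mem by blast
      then show False
        using ac[OF T(2)] inj_c T by (auto simp: inj_on_def)
    qed
    show "(\<exists>i\<le>n. P = A i) \<or> (\<exists>i\<le>n. \<exists>j\<le>n. i \<noteq> j \<and> P \<in> l i \<inter> l j)" if P: "P \<in> X" for P
    proof (cases "P = B")
      case True
      then show ?thesis
        by (auto simp: A_def)
    next
      case False
      then obtain T where T: "T \<in> triplets" "P \<in> opp T"
        using full_node_on_line[OF full P] by blast
      obtain i where i: "i < n" "T = h i"
        using h_surj[OF T(1)] by blast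
      consider "P = c T" | "P = a T" | "P \<notin> T"
        using ac[OF T(1)] False by blast
      then show ?thesis
      proof cases
        case 1
        then show ?thesis
          using i by (intro disjI1 exI[of _ i]) (simp add: A_def)
      next
        case 2
        then show ?thesis
          using i T M by (intro disjI2 exI[of _ i] conjI exI[of _ n]) (auto simp: l_def)
      next
        case 3
        then obtain T' where T': "T' \<in> triplets" "T' \<noteq> T" "P \<in> opp T'"
          using full_node_on_two_lines[OF full T(1) P T(2)] by blast
        obtain j where "j < n" "T' = h j"
          using h_surj[OF T'(1)] by blast
        then show ?thesis
          using i T T' by (intro disjI2 exI[of _ i] conjI exI[of _ j]) (auto simp: l_def)
      qed
    qed
  qed
  then show ?thesis
    using card_all card_off through by simp
qed

end

end

theorem corollary3p4:
  fixes n :: nat and X :: "point set" and B :: point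
  assumes "B \<in> X"
  shows
    "(n_correct n X \<and> n \<ge> 2 \<longrightarrow>
        finite {T. special_triplet n X T \<and> B \<in> T} \<and>
        card {T. special_triplet n X T \<and> B \<in> T} \<le> n \<and>
        (card {T. special_triplet n X T \<and> B \<in> T} = n \<longrightarrow>
           card {L. maximal_line n X L \<and> B \<notin> L} = n)) \<and>
     (GC_set n X \<and> n \<ge> 3 \<longrightarrow>
        finite {L. node_line X 2 L \<and> used_line n X L \<and> B \<in> L} \<and>
        card {L. node_line X 2 L \<and> used_line n X L \<and> B \<in> L} \<le> n \<and>
        (card {L. node_line X 2 L \<and> used_line n X L \<and> B \<in> L} = n \<longrightarrow>
           card {L. maximal_line n X L} = n + 1 \<and>
           card {L. maximal_line n X L \<and> B \<notin> L} = n \<and>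
           card {L. maximal_line n X L \<and> B \<in> L} = 1 \<and>
           Carnicer_Gasca_set n X))"
proof (intro conjI impI; (elim conjE)?)
  assume "n_correct n X" "n \<ge> 2"
  then interpret pointed_correct_set n X B
    using assms by unfold_locales
  let ?S = "{T. special_triplet n X T \<and> B \<in> T}"
  have sub: "?S \<subseteq> triplets"
    using special_triplet_imp_triplet by (auto simp: triplets_def)
  then show "finite ?S"
    using finite_triplets finite_subset by blast
  show "card ?S \<le> n"
    using card_mono[OF finite_triplets sub] card_triplets_le by linarith
  assume "card ?S = n"
  \<comment> \<open>The special triplets form a subset of \<open>triplets\<close>, which has at most
    \<open>n\<close> elements, so \<open>n\<close> special triplets force equality.\<close>
  then have "card triplets = n"
    using card_mono[OF finite_triplets sub] card_triplets_le by linarith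
  then show "card {L. maximal_line n X L \<and> B \<notin> L} = n"
    by (simp add: full_maximal_lines card_image[OF inj_on_opp])
next
  assume GC: "GC_set n X" "n \<ge> 3"
  then interpret pointed_GC_set n X B
    using assms by unfold_locales (auto simp: GC_set_def)
  show "finite {L. node_line X 2 L \<and> used_line n X L \<and> B \<in> L}"
    and "card {L. node_line X 2 L \<and> used_line n X L \<and> B \<in> L} \<le> n"
    using finite_used_lines card_used_lines by (simp_all add: used_lines_def)
  assume "card {L. node_line X 2 L \<and> used_line n X L \<and> B \<in> L} = n"
  then have "card used_lines = n"
    by (simp add: used_lines_def)
  from full_structure[OF this]
  show "card {L. maximal_line n X L} = n + 1" "card {L. maximal_line n X L \<and> B \<notin> L} = n"
    "card {L. maximal_line n X L \<and> B \<in> L} = 1" "Carnicer_Gasca_set n X" by auto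
qed

end
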